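(* Let $(u,c)$ be a weak entropy solution on $(0,\infty)_t\times(0,\infty)_x$ of the system $$\partial_x(uc)+\partial_t I(c)=0,\qquad \partial_x u+\partial_t h(c)=0 .$$ Then there exists a nonnegative measure $m=m(t,x,\xi)$ on $(0,\infty)_t\times(0,\infty)_x\times(0,1)_\xi$ such that, in the sense of distributions, $$\partial_x\big(u\,\chi(c,\xi)\big)+a(\xi)\,\partial_t\chi(c,\xi)+\partial_t\big(h(c)\,\chi(c,\xi)\big)=\partial_\xi m,$$ where $a(\xi)=H(\xi)-h(\xi)=1+f'(\xi)$.
   Context: The functions $q_1,q_2:[0,1]\to\mathbb{R}$ (isotherms) are continuously differentiable with $q_1'\ge 0\ge q_2'$ and $q_1+q_2\ge 0$. Set $h(c)=q_1(c)+q_2(c)$, $I(c)=c+q_1(c)$, $f(c)=q_1(c)-c\,h(c)$, and $H(c)=1+q_1'(c)-c\,h'(c)=1+(1-c)q_1'(c)-c\,q_2'(c)\ge 1$. The unknowns are measurable functions $c$ with values in $[0,1]$ and $u>0$ with $u\in L^\infty_{loc}$. The variable $x$ plays the role of the evolution variable. $(u,c)$ is a weak entropy solution if it satisfies the system in the sense of distributions and if, for every smooth $\psi:[0,1]\to\mathbb{R}$ with $\psi''\ge 0$, $$\partial_x\big(u\,\psi(c)\big)+\partial_t Q(c)\le 0$$ in the sense of distributions, where $Q$ is any function with $Q'(c)=h'(c)\,\psi(c)+H(c)\,\psi'(c)$. The function $\chi$ is $\chi(c,\xi)=1$ if $0<\xi<c$ and $\chi(c,\xi)=0$ otherwise. 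*)

theory Defs
  imports "HOL-Analysis.Analysis"
begin

section \<open>Isotherms and derived functions on \<open>[0,1]\<close>\<close>

text \<open>Derivative of a function on \<open>[0,1]\<close>, one-sided at the end points. For \<open>c\<close> in \<open>[0,1]\<close> it does
  not depend on the values of \<open>g\<close> outside \<open>[0,1]\<close>; it is only used there.\<close>

definition D01 :: "(real \<Rightarrow> real) \<Rightarrow> real \<Rightarrow> real" where
  "D01 g c = vector_derivative g (at c within {0..1})"

definition C1_on01 :: "(real \<Rightarrow> real) \<Rightarrow> bool" where
  "C1_on01 g \<longleftrightarrow>
     (\<forall>c\<in>{0..1}. g differentiable (at c within {0..1})) \<and> continuous_on {0..1} (D01 g)"

definition smooth_on01 :: "(real \<Rightarrow> real) \<Rightarrow> bool" where
  "smooth_on01 g \<longleftrightarrow> (\<forall>k. \<forall>c\<in>{0..1}. ((D01 ^^ k) g) differentiable (at c within {0..1}))"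

definition isotherms :: "(real \<Rightarrow> real) \<Rightarrow> (real \<Rightarrow> real) \<Rightarrow> bool" where
  "isotherms q1 q2 \<longleftrightarrow>
     C1_on01 q1 \<and> C1_on01 q2 \<and>
     (\<forall>c\<in>{0..1}. D01 q1 c \<ge> 0 \<and> 0 \<ge> D01 q2 c) \<and>
     (\<forall>c\<in>{0..1}. q1 c + q2 c \<ge> 0)"

definition iso_h :: "(real \<Rightarrow> real) \<Rightarrow> (real \<Rightarrow> real) \<Rightarrow> real \<Rightarrow> real" where
  "iso_h q1 q2 c = q1 c + q2 c"

definition iso_I :: "(real \<Rightarrow> real) \<Rightarrow> real \<Rightarrow> real" where
  "iso_I q1 c = c + q1 c"

definition iso_f :: "(real \<Rightarrow> real) \<Rightarrow> (real \<Rightarrow> real) \<Rightarrow> real \<Rightarrow> real" where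
  "iso_f q1 q2 c = q1 c - c * iso_h q1 q2 c"

definition iso_H :: "(real \<Rightarrow> real) \<Rightarrow> (real \<Rightarrow> real) \<Rightarrow> real \<Rightarrow> real" where
  "iso_H q1 q2 c = 1 + D01 q1 c - c * D01 (iso_h q1 q2) c"

definition iso_a :: "(real \<Rightarrow> real) \<Rightarrow> (real \<Rightarrow> real) \<Rightarrow> real \<Rightarrow> real" where
  "iso_a q1 q2 \<xi> = iso_H q1 q2 \<xi> - iso_h q1 q2 \<xi>"

definition chi :: "real \<Rightarrow> real \<Rightarrow> real" where
  "chi c \<xi> = (if 0 < \<xi> \<and> \<xi> < c then 1 else 0)"


section \<open>Test functions and distributions\<close>

fun Ck :: "nat \<Rightarrow> ('a::euclidean_space \<Rightarrow> real) \<Rightarrow> bool" where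
  "Ck 0 g \<longleftrightarrow> continuous_on UNIV g"
| "Ck (Suc k) g \<longleftrightarrow>
     (\<forall>p. g differentiable (at p)) \<and> (\<forall>b\<in>Basis. Ck k (\<lambda>p. frechet_derivative g (at p) b))"

text \<open>The space of smooth functions with compact support in the open set \<open>U\<close>, each extended by \<open>0\<close>
  to the whole space.\<close>

definition test_functions :: "'a::euclidean_space set \<Rightarrow> ('a \<Rightarrow> real) set" where
  "test_functions U =
     {\<phi>. (\<forall>k. Ck k \<phi>) \<and> compact (closure {p. \<phi> p \<noteq> 0}) \<and> closure {p. \<phi> p \<noteq> 0} \<subseteq> U}"

text \<open>Distributions are represented by their action on test functions. All densities used below are
  measurable and locally bounded, so the integrals exist.\<close>

definition dist_fun :: "'a::euclidean_space set \<Rightarrow> ('a \<Rightarrow> real) \<Rightarrow> ('a \<Rightarrow> real) \<Rightarrow> real" where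
  "dist_fun U F \<phi> = (\<integral>p. F p * \<phi> p \<partial>(lebesgue_on U))"

definition dist_measure :: "'a::euclidean_space measure \<Rightarrow> ('a \<Rightarrow> real) \<Rightarrow> real" where
  "dist_measure m \<phi> = (\<integral>p. \<phi> p \<partial>m)"

definition dist_deriv ::
    "'a::euclidean_space \<Rightarrow> (('a \<Rightarrow> real) \<Rightarrow> real) \<Rightarrow> ('a \<Rightarrow> real) \<Rightarrow> real" where
  "dist_deriv b T \<phi> = - T (\<lambda>p. frechet_derivative \<phi> (at p) b)"

definition radon_measure_on :: "'a::euclidean_space set \<Rightarrow> 'a measure \<Rightarrow> bool" where
  "radon_measure_on U m \<longleftrightarrow>
     sets m = sets (restrict_space borel U) \<and>
     (\<forall>K. compact K \<and> K \<subseteq> U \<longrightarrow> emeasure m K < \<infinity>)"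

definition Linf_loc :: "'a::euclidean_space set \<Rightarrow> ('a \<Rightarrow> real) \<Rightarrow> bool" where
  "Linf_loc U g \<longleftrightarrow>
     g \<in> borel_measurable (lebesgue_on U) \<and>
     (\<forall>K. compact K \<and> K \<subseteq> U \<longrightarrow> (\<exists>C. AE p in lebesgue_on K. \<bar>g p\<bar> \<le> C))"


section \<open>Weak entropy solutions\<close>

text \<open>Points are written \<open>(t, x)\<close> and \<open>(t, x, \<xi>)\<close>, in this order.\<close>

definition Omega :: "(real \<times> real) set" where
  "Omega = {0<..} \<times> {0<..}"

definition Omega_kin :: "(real \<times> real \<times> real) set" where
  "Omega_kin = {0<..} \<times> {0<..} \<times> {0<..<1}"

text \<open>The distribution \<open>\<partial>\<^sub>x F + \<partial>\<^sub>t G\<close> on \<open>Omega\<close>.\<close>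

definition balance ::
    "(real \<times> real \<Rightarrow> real) \<Rightarrow> (real \<times> real \<Rightarrow> real) \<Rightarrow> (real \<times> real \<Rightarrow> real) \<Rightarrow> real" where
  "balance F G \<phi> =
     dist_deriv (0, 1) (dist_fun Omega F) \<phi> + dist_deriv (1, 0) (dist_fun Omega G) \<phi>"

definition weak_solution ::
    "(real \<Rightarrow> real) \<Rightarrow> (real \<Rightarrow> real) \<Rightarrow> (real \<times> real \<Rightarrow> real) \<Rightarrow> (real \<times> real \<Rightarrow> real) \<Rightarrow> bool" where
  "weak_solution q1 q2 u c \<longleftrightarrow>
     (\<forall>\<phi>\<in>test_functions Omega.
        balance (\<lambda>p. u p * c p) (\<lambda>p. iso_I q1 (c p)) \<phi> = 0 \<and>
        balance u (\<lambda>p. iso_h q1 q2 (c p)) \<phi> = 0)"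

text \<open>For a given \<open>\<psi>\<close>, the function \<open>Q\<close> is determined on \<open>[0,1]\<close> up to an additive constant, which
  does not affect \<open>\<partial>\<^sub>t Q(c)\<close>.\<close>

definition entropy_condition ::
    "(real \<Rightarrow> real) \<Rightarrow> (real \<Rightarrow> real) \<Rightarrow> (real \<times> real \<Rightarrow> real) \<Rightarrow> (real \<times> real \<Rightarrow> real) \<Rightarrow> bool" where
  "entropy_condition q1 q2 u c \<longleftrightarrow>
     (\<forall>\<psi> Q. smooth_on01 \<psi> \<and> (\<forall>s\<in>{0..1}. (D01 ^^ 2) \<psi> s \<ge> 0) \<and>
        (\<forall>s\<in>{0..1}. (Q has_real_derivative
            D01 (iso_h q1 q2) s * \<psi> s + iso_H q1 q2 s * D01 \<psi> s) (at s within {0..1})) \<longrightarrow>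
        (\<forall>\<phi>\<in>test_functions Omega. (\<forall>p. \<phi> p \<ge> 0) \<longrightarrow>
           balance (\<lambda>p. u p * \<psi> (c p)) (\<lambda>p. Q (c p)) \<phi> \<le> 0))"

definition weak_entropy_solution ::
    "(real \<Rightarrow> real) \<Rightarrow> (real \<Rightarrow> real) \<Rightarrow> (real \<times> real \<Rightarrow> real) \<Rightarrow> (real \<times> real \<Rightarrow> real) \<Rightarrow> bool" where
  "weak_entropy_solution q1 q2 u c \<longleftrightarrow>
     c \<in> borel_measurable (lebesgue_on Omega) \<and>
     (AE p in lebesgue_on Omega. c p \<in> {0..1}) \<and>
     Linf_loc Omega u \<and>
     (AE p in lebesgue_on Omega. u p > 0) \<and>
     weak_solution q1 q2 u c \<and>
     entropy_condition q1 q2 u c"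

text \<open>The identity
  \<open>\<partial>\<^sub>x (u \<chi>(c,\<xi>)) + a(\<xi>) \<partial>\<^sub>t \<chi>(c,\<xi>) + \<partial>\<^sub>t (h(c) \<chi>(c,\<xi>)) = \<partial>\<^sub>\<xi> m\<close> of distributions. The factor \<open>a\<close> is only
  continuous, but it does not depend on \<open>t\<close>, so the product \<open>a(\<xi>) \<partial>\<^sub>t \<chi>\<close> is the distribution
  \<open>\<partial>\<^sub>t (a(\<xi>) \<chi>)\<close>.\<close>

definition kinetic_equation ::
    "(real \<Rightarrow> real) \<Rightarrow> (real \<Rightarrow> real) \<Rightarrow> (real \<times> real \<Rightarrow> real) \<Rightarrow> (real \<times> real \<Rightarrow> real)
      \<Rightarrow> (real \<times> real \<times> real) measure \<Rightarrow> bool" where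
  "kinetic_equation q1 q2 u c m \<longleftrightarrow>
     (\<forall>\<phi>\<in>test_functions Omega_kin.
        dist_deriv (0, 1, 0)
          (dist_fun Omega_kin (\<lambda>(t, x, \<xi>). u (t, x) * chi (c (t, x)) \<xi>)) \<phi>
        + dist_deriv (1, 0, 0)
          (dist_fun Omega_kin (\<lambda>(t, x, \<xi>). iso_a q1 q2 \<xi> * chi (c (t, x)) \<xi>)) \<phi>
        + dist_deriv (1, 0, 0)
          (dist_fun Omega_kin (\<lambda>(t, x, \<xi>). iso_h q1 q2 (c (t, x)) * chi (c (t, x)) \<xi>)) \<phi>
        = dist_deriv (0, 0, 1) (dist_measure m) \<phi>)"

end

theory Submission
  imports Defs
begin

text \<open>Integrating the kinetic equation in \<open>\<xi>\<close> from \<open>0\<close> determines \<open>m\<close> as a distribution: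
  \<open>m = \<partial>\<^sub>x (u min(c,\<xi>)) + \<partial>\<^sub>t (A(min(c,\<xi>)) + h(c) min(c,\<xi>))\<close> with \<open>A(s) = \<integral>\<^sub>0\<^sup>s a\<close>. For fixed \<open>\<xi>\<close> the right-hand
  side is minus the entropy production of the convex function \<open>\<psi>(s) = (s - \<xi>)\<^sup>+ - s\<close>, which is a limit of
  smooth convex functions \<open>ln (1 + exp (n (s - \<xi>))) / n - s\<close>; hence the distribution \<open>m\<close> is nonnegative.
  By the Riesz representation theorem, obtained here from an outer measure built with smooth cut-offs,
  a nonnegative distribution is a Radon measure. Finally \<open>\<partial>\<^sub>\<xi> m\<close> is computed by integrating by parts
  in \<open>\<xi>\<close>.\<close>

section \<open>Smooth functions\<close>

text \<open>Three features of the data shape the argument. First, \<open>u\<close> and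
  \<open>c\<close> are only Lebesgue measurable and constrained almost everywhere, while
  \<open>a\<close> and \<open>h\<close> are controlled only on [0,1]. So \<open>u\<close> and
  \<open>c\<close> give way to Borel representatives \<open>v\<close> and \<open>C\<close>, with
  \<open>C\<close> in [0,1] at every point, and other arguments are clamped to [0,1]. Second, the
  entropy inequality lives on (t,x) for one \<xi> at a time, whereas positivity of \<open>m\<close>
  concerns test functions of three variables. A slice at fixed \<xi> is again a test function, so
  Fubini adds up the family of inequalities. Third, \<open>a\<close> is merely continuous, so it is
  never differentiated: only its primitive \<open>A\<close> and derivatives of test functions occur.
  The subtracted \<open>s\<close> in the entropy turns (s - \<xi>)^+ into - min s \<xi>, the
  negative of the \<xi>-primitive of \<open>chi s\<close> that vanishes at \<xi> = 0; thus no
  boundary term appears. Testing \<open>m\<close> with a \<xi>-derivative leads to mixed second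
  derivatives of the test function, whose order must be exchanged before integrating by
  parts.\<close>

lemma frechet_derivative_eqI:
  "(g has_derivative g') (at p) \<Longrightarrow> frechet_derivative g (at p) = g'"
  by (metis frechet_derivative_at)

lemma Ck_SucI:
  assumes "\<And>p. (g has_derivative g' p) (at p)"
    and "\<And>b. b \<in> Basis \<Longrightarrow> Ck k (\<lambda>p. g' p b)"
  shows "Ck (Suc k) g"
  using assms frechet_derivative_eqI[OF assms(1)] by (auto simp: differentiable_def)

lemma Ck_Suc_has_derivative:
  "Ck (Suc k) g \<Longrightarrow> (g has_derivative frechet_derivative g (at p)) (at p)"
  by (simp add: frechet_derivative_works)

lemma Ck_SucD: "Ck (Suc k) g \<Longrightarrow> Ck k g"
proof (induction k arbitrary: g)
  case 0
  then show ?case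
    by (auto simp: continuous_on_eq_continuous_at differentiable_imp_continuous_within)
next
  case (Suc k)
  then have "\<forall>p. g differentiable (at p)"
    and "\<forall>b\<in>Basis. Ck (Suc k) (\<lambda>p. frechet_derivative g (at p) b)"
    by simp_all
  with Suc.IH show ?case by (auto simp del: Ck.simps(2) simp add: Ck.simps(2)[of k g])
qed

lemma Ck_continuous: "Ck k g \<Longrightarrow> continuous_on UNIV g"
  by (induction k) (auto dest: Ck_SucD simp del: Ck.simps(2))

lemma Ck_const: "Ck k (\<lambda>p. a)"
proof (induction k arbitrary: a)
  case (Suc k)
  show ?case by (rule Ck_SucI[where g' = "\<lambda>p b. 0"]) (auto intro: Suc)
qed auto

lemma Ck_add: "Ck k f \<Longrightarrow> Ck k g \<Longrightarrow> Ck k (\<lambda>p. f p + g p)"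
proof (induction k arbitrary: f g)
  case (Suc k)
  show ?case
    by (rule Ck_SucI[OF has_derivative_add[OF Ck_Suc_has_derivative[OF Suc.prems(1)]
          Ck_Suc_has_derivative[OF Suc.prems(2)]]])
      (use Suc in auto)
qed (auto intro: continuous_intros)

text \<open>The product rule leaves \<open>f\<close> and \<open>g\<close> themselves
  undifferentiated in one factor each; \<open>Ck_SucD\<close> supplies them at the lower
  order.\<close>

lemma Ck_mult: "Ck k f \<Longrightarrow> Ck k g \<Longrightarrow> Ck k (\<lambda>p. f p * g p)"
proof (induction k arbitrary: f g)
  case (Suc k)
  show ?case
    by (rule Ck_SucI[OF has_derivative_mult[OF Ck_Suc_has_derivative[OF Suc.prems(1)]
          Ck_Suc_has_derivative[OF Suc.prems(2)]]], rule Ck_add)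
      (use Suc Ck_SucD[OF Suc.prems(1)] Ck_SucD[OF Suc.prems(2)] in auto)
qed (auto intro: continuous_intros)

lemma Ck_cmult: "Ck k g \<Longrightarrow> Ck k (\<lambda>p. r * g p)"
  by (rule Ck_mult[OF Ck_const])

lemma Ck_diff: "Ck k f \<Longrightarrow> Ck k g \<Longrightarrow> Ck k (\<lambda>p. f p - g p)"
  using Ck_add[of k f "\<lambda>p. -1 * g p"] Ck_cmult[of k g "-1"] by simp

lemma Ck_sum: "finite I \<Longrightarrow> (\<And>i. i \<in> I \<Longrightarrow> Ck k (f i)) \<Longrightarrow> Ck k (\<lambda>p. \<Sum>i\<in>I. f i p)"
  by (induction rule: finite_induct) (auto intro: Ck_const Ck_add)

lemma Ck_inner: "Ck k (\<lambda>p. (p - q) \<bullet> b)"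
proof (cases k)
  case (Suc l)
  show ?thesis unfolding Suc
    by (rule Ck_SucI[where g' = "\<lambda>p v. v \<bullet> b"])
      (auto intro!: derivative_eq_intros Ck_const)
qed (auto intro!: continuous_intros)

text \<open>The norm itself is not differentiable at \<open>q\<close>, but its square is a
  polynomial in the coordinates.\<close>

lemma Ck_norm_square: "Ck k (\<lambda>p. (norm (p - q))\<^sup>2)"
proof -
  have "(norm (p - q))\<^sup>2 = (\<Sum>b\<in>Basis. ((p - q) \<bullet> b) * ((p - q) \<bullet> b))" for p
    by (simp add: power2_norm_eq_inner euclidean_inner[of "p - q" "p - q"])
  then show ?thesis by (simp only:) (intro Ck_sum Ck_mult Ck_inner finite_Basis)
qed

lemma Ck_inverse:
  assumes "Ck k g" and "\<And>p. g p \<noteq> 0"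
  shows "Ck k (\<lambda>p. inverse (g p))"
  using assms(1)
proof (induction k)
  case 0
  then show ?case using assms(2) by (auto intro: continuous_intros)
next
  case (Suc k)
  have I: "Ck k (\<lambda>p. inverse (g p))" by (rule Suc.IH[OF Ck_SucD[OF Suc.prems]])
  have "((\<lambda>p. inverse (g p)) has_derivative
      (\<lambda>v. -1 * (inverse (g p) * frechet_derivative g (at p) v * inverse (g p)))) (at p)" for p
    using Deriv.has_derivative_inverse[OF assms(2) Ck_Suc_has_derivative[OF Suc.prems, of p]] by simp
  then show ?case
    by (rule Ck_SucI) (use I Suc.prems in \<open>intro Ck_cmult Ck_mult, auto\<close>)
qed

text \<open>For \<open>s > 0\<close>, \<open>flat j s = s\<^bsup>-j\<^esup> exp (- 1/s)\<close>; this family is closed under differentiation up to linear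
  combinations, so all its members are smooth.\<close>

definition flat :: "nat \<Rightarrow> real \<Rightarrow> real" where
  "flat j s = (if 0 < s then inverse s ^ j * exp (- inverse s) else 0)"

lemma flat_tendsto_0: "((\<lambda>s. inverse s ^ j * exp (- inverse s)) \<longlongrightarrow> (0::real)) (at_right 0)"
proof -
  have "((\<lambda>x. x ^ j / exp x) \<longlongrightarrow> (0::real)) at_top" by (rule tendsto_power_div_exp_0)
  from filterlim_compose[OF this filterlim_inverse_at_top_right]
  show ?thesis by (simp add: exp_minus field_simps)
qed

lemma flat_has_derivative:
  "(flat j has_real_derivative - real j * flat (Suc j) s + flat (j + 2) s) (at s)"
proof -
  consider "s < 0" | "s = 0" | "0 < s" by linarith
  then show ?thesis
  proof cases
    case 1
    have "((\<lambda>s. 0) has_real_derivative 0) (at s)" by simp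
    then have "(flat j has_real_derivative 0) (at s)"
      by (rule has_field_derivative_transform_within_open[where S = "{..<0}"])
        (use 1 in \<open>auto simp: flat_def\<close>)
    then show ?thesis using 1 by (simp add: flat_def)
  next
    case 2
    \<comment> \<open>Dividing by \<open>y > 0\<close> raises the power of \<open>inverse y\<close>
      by one, so the right difference quotient at 0 is the formula of \<open>flat (Suc j)\<close>,
      which tends to 0.\<close>
    have "((\<lambda>y. (flat j y - flat j 0) / (y - 0)) \<longlongrightarrow> 0) (at_right 0)"
      by (rule Lim_transform_eventually[OF flat_tendsto_0[of "Suc j"]])
        (auto simp: eventually_at_right_field flat_def field_simps intro!: exI[of _ 1])
    moreover have "((\<lambda>y. (flat j y - flat j 0) / (y - 0)) \<longlongrightarrow> 0) (at_left 0)"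
      by (rule Lim_transform_eventually[OF tendsto_const])
        (auto simp: eventually_at_left_field flat_def intro!: exI[of _ "-1"])
    ultimately have "(flat j has_real_derivative 0) (at 0)"
      unfolding has_field_derivative_iff by (simp add: filterlim_split_at)
    then show ?thesis using 2 by (simp add: flat_def)
  next
    case 3
    have "((\<lambda>s. inverse s ^ j * exp (- inverse s)) has_real_derivative
        - real j * (inverse s ^ Suc j * exp (- inverse s)) + inverse s ^ (j + 2) * exp (- inverse s))
        (at s)"
    proof -
      have "((\<lambda>s. inverse s ^ j) has_real_derivative - real j * inverse s ^ Suc j) (at s)"
        using DERIV_power[OF DERIV_inverse, of s j UNIV] 3
        by (cases j) (simp_all add: power2_eq_square algebra_simps)
      moreover have "((\<lambda>s. exp (- inverse s)) has_real_derivative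
          exp (- inverse s) * (inverse s)\<^sup>2) (at s)"
        using 3 by (auto intro!: derivative_eq_intros simp: power2_eq_square)
      ultimately show ?thesis
        by (rule DERIV_mult[THEN DERIV_cong])
          (simp add: power2_eq_square algebra_simps)
    qed
    then have "(flat j has_real_derivative
        - real j * (inverse s ^ Suc j * exp (- inverse s)) + inverse s ^ (j + 2) * exp (- inverse s))
        (at s)"
      by (rule has_field_derivative_transform_within_open[where S = "{0<..}"])
        (use 3 in \<open>auto simp: flat_def\<close>)
    then show ?thesis using 3 by (simp add: flat_def)
  qed
qed

text \<open>The induction must range over all \<open>j\<close>, since one differentiation leads from
  \<open>flat j\<close> to \<open>flat (Suc j)\<close> and \<open>flat (j + 2)\<close>.\<close>

lemma Ck_flat: "Ck k g \<Longrightarrow> Ck k (\<lambda>p. flat j (g p))"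
proof (induction k arbitrary: j)
  case 0
  have "continuous_on UNIV (flat j)"
    by (meson DERIV_isCont continuous_at_imp_continuous_on flat_has_derivative)
  with 0 show ?case
    by (auto intro: continuous_on_compose2)
next
  case (Suc k)
  have I: "Ck k (\<lambda>p. flat j (g p))" for j by (rule Suc.IH[OF Ck_SucD[OF Suc.prems]])
  have "((\<lambda>p. flat j (g p)) has_derivative
      (\<lambda>v. (- real j * flat (Suc j) (g p) + flat (j + 2) (g p)) * frechet_derivative g (at p) v))
      (at p)" for p
    using has_derivative_compose[OF Ck_Suc_has_derivative[OF Suc.prems, of p]
        flat_has_derivative[of j "g p", unfolded has_field_derivative_def]] .
  then show ?case
    by (rule Ck_SucI) (use Suc.prems in \<open>intro Ck_mult Ck_add Ck_cmult I, auto\<close>)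
qed

lemma flat_nonneg: "0 \<le> flat j s" by (simp add: flat_def)

lemma flat_pos_iff: "0 < flat j s \<longleftrightarrow> 0 < s" by (simp add: flat_def)

lemma flat_eq_0_iff: "flat j s = 0 \<longleftrightarrow> s \<le> 0" by (auto simp add: flat_def)

section \<open>Test functions\<close>

definition supp :: "('a::euclidean_space \<Rightarrow> real) \<Rightarrow> 'a set" where
  "supp g = closure {p. g p \<noteq> 0}"

lemma not_in_supp: "p \<notin> supp g \<Longrightarrow> g p = 0"
  using closure_subset[of "{p. g p \<noteq> 0}"] by (auto simp: supp_def)

lemma supp_subsetI: "closed K \<Longrightarrow> (\<And>p. p \<notin> K \<Longrightarrow> g p = 0) \<Longrightarrow> supp g \<subseteq> K"
  unfolding supp_def by (rule closure_minimal) auto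

lemma closed_supp [simp]: "closed (supp g)"
  by (simp add: supp_def)

lemma test_functions_iff:
  "\<phi> \<in> test_functions U \<longleftrightarrow> (\<forall>k. Ck k \<phi>) \<and> compact (supp \<phi>) \<and> supp \<phi> \<subseteq> U"
  by (simp add: test_functions_def supp_def)

lemma test_functions_mono: "U \<subseteq> V \<Longrightarrow> test_functions U \<subseteq> test_functions V"
  by (fastforce simp: test_functions_iff)

text \<open>Any compact set outside which \<phi> vanishes contains the support, and a closed subset
  of a compact set is compact; supports never have to be computed exactly.\<close>

lemma test_functionsI:
  assumes "\<And>k. Ck k \<phi>" "compact K" "K \<subseteq> U" "\<And>p. p \<notin> K \<Longrightarrow> \<phi> p = 0"
  shows "\<phi> \<in> test_functions U"
proof -
  have "supp \<phi> \<subseteq> K" using assms by (intro supp_subsetI compact_imp_closed)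
  with assms show ?thesis
    unfolding test_functions_iff using compact_Int_closed[of K "supp \<phi>"]
    by (auto simp: Int_absorb1)
qed

lemma test_functions_continuous: "\<phi> \<in> test_functions U \<Longrightarrow> continuous_on UNIV \<phi>"
  by (auto simp: test_functions_iff intro: Ck_continuous)

lemma test_functions_zero: "(\<lambda>p. 0) \<in> test_functions U"
  by (rule test_functionsI[where K = "{}"]) (auto intro: Ck_const)

lemma test_functions_add:
  "f \<in> test_functions U \<Longrightarrow> g \<in> test_functions U \<Longrightarrow> (\<lambda>p. f p + g p) \<in> test_functions U"
  by (rule test_functionsI[where K = "supp f \<union> supp g"])
    (auto simp: test_functions_iff not_in_supp intro: Ck_add)

lemma test_functions_mult:
  assumes "f \<in> test_functions U" "\<And>k. Ck k g"
  shows "(\<lambda>p. g p * f p) \<in> test_functions U"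
  by (rule test_functionsI[where K = "supp f"])
    (use assms in \<open>auto simp: test_functions_iff not_in_supp intro: Ck_mult\<close>)

lemma test_functions_cmult: "f \<in> test_functions U \<Longrightarrow> (\<lambda>p. r * f p) \<in> test_functions U"
  by (rule test_functions_mult[OF _ Ck_const])

lemma test_functions_diff:
  "f \<in> test_functions U \<Longrightarrow> g \<in> test_functions U \<Longrightarrow> (\<lambda>p. f p - g p) \<in> test_functions U"
  using test_functions_add[OF _ test_functions_cmult[of g U "-1"], of f] by simp

lemma test_functions_sum:
  "finite I \<Longrightarrow> (\<And>i. i \<in> I \<Longrightarrow> f i \<in> test_functions U) \<Longrightarrow>
    (\<lambda>p. \<Sum>i\<in>I. f i p) \<in> test_functions U"
  by (induction rule: finite_induct) (auto intro: test_functions_zero test_functions_add)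

lemma test_functions_has_derivative:
  assumes "\<phi> \<in> test_functions U"
  shows "(\<phi> has_derivative frechet_derivative \<phi> (at p)) (at p)"
proof -
  have "Ck (Suc 0) \<phi>" using assms by (auto simp: test_functions_iff simp del: Ck.simps)
  then show ?thesis by (rule Ck_Suc_has_derivative)
qed

lemma frechet_derivative_not_in_supp:
  assumes "p \<notin> supp \<phi>"
  shows "frechet_derivative \<phi> (at p) b = 0"
proof -
  have "((\<lambda>p. 0) has_derivative (\<lambda>v. 0)) (at p)" by simp
  then have "(\<phi> has_derivative (\<lambda>v. 0)) (at p)"
    by (rule has_derivative_transform_within_open[where s = "- supp \<phi>"])
      (use assms in \<open>auto simp: not_in_supp open_Compl\<close>)
  then show ?thesis by (simp add: frechet_derivative_eqI)
qed

lemma test_functions_frechet_derivative: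
  assumes "\<phi> \<in> test_functions U" "b \<in> Basis"
  shows "(\<lambda>p. frechet_derivative \<phi> (at p) b) \<in> test_functions U"
proof (rule test_functionsI[where K = "supp \<phi>"])
  fix k
  have "Ck (Suc k) \<phi>" using assms by (auto simp: test_functions_iff simp del: Ck.simps)
  then show "Ck k (\<lambda>p. frechet_derivative \<phi> (at p) b)" using assms(2) by simp
qed (use assms in \<open>auto simp: test_functions_iff frechet_derivative_not_in_supp\<close>)

lemma test_functions_bounded:
  assumes "\<phi> \<in> test_functions U"
  obtains C where "0 \<le> C" "\<And>p. \<bar>\<phi> p\<bar> \<le> C"
proof -
  have "compact (\<phi> ` supp \<phi>)"
    using assms test_functions_continuous[OF assms]
    by (auto simp: test_functions_iff intro!: compact_continuous_image intro: continuous_on_subset)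
  then obtain C where C: "\<And>y. y \<in> \<phi> ` supp \<phi> \<Longrightarrow> norm y \<le> C"
    using compact_imp_bounded bounded_iff by metis
  have "\<bar>\<phi> p\<bar> \<le> max C 0" for p
    using C[of "\<phi> p"] not_in_supp[of p \<phi>] by (cases "p \<in> supp \<phi>") auto
  then show thesis using that[of "max C 0"] by simp
qed

text \<open>A finite cover of \<open>K\<close> by balls whose closures lie in \<open>V\<close> gives
  a sum \<open>S\<close> of smooth bumps that is positive on \<open>K\<close>, hence bounded below
  there. Composing with a smooth step function flattens it to 1. The value 1 is reached on an open
  \<open>W\<close> and not only on \<open>K\<close>: this leaves room for \<open>1 - g\<close> to
  vanish near \<open>K\<close>.\<close>

lemma smooth_Urysohn:
  fixes K V :: "'a::euclidean_space set"
  assumes K: "compact K" and V: "open V" and KV: "K \<subseteq> V"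
  obtains g W where "g \<in> test_functions V" "\<And>p. 0 \<le> g p" "\<And>p. g p \<le> 1"
    "open W" "K \<subseteq> W" "\<And>p. p \<in> W \<Longrightarrow> g p = 1"
proof -
  have "\<exists>r. 0 < r \<and> cball x r \<subseteq> V" if "x \<in> K" for x
    using that V KV by (auto simp: open_contains_cball)
  then obtain r where r: "\<And>x. x \<in> K \<Longrightarrow> 0 < r x" "\<And>x. x \<in> K \<Longrightarrow> cball x (r x) \<subseteq> V"
    by metis
  have "K \<subseteq> (\<Union>x\<in>K. ball x (r x))" using r(1) by force
  then obtain D where D: "D \<subseteq> K" "finite D" "K \<subseteq> (\<Union>x\<in>D. ball x (r x))"
    using compactE_image[OF K, of K "\<lambda>x. ball x (r x)"] by (metis open_ball)
  define S where "S p = (\<Sum>x\<in>D. flat 0 ((r x)\<^sup>2 - (norm (p - x))\<^sup>2))" for p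
  have S_smooth: "Ck k S" for k
    unfolding S_def by (intro Ck_sum Ck_flat Ck_diff Ck_const Ck_norm_square D)
  have S_nonneg: "0 \<le> S p" for p
    unfolding S_def by (intro sum_nonneg flat_nonneg)
  have S_pos: "0 < S p" if pK: "p \<in> K" for p
  proof -
    obtain x where x: "x \<in> D" "p \<in> ball x (r x)" using D(3) pK by blast
    then have "norm (p - x) < r x" by (simp add: dist_norm norm_minus_commute)
    then have "(norm (p - x))\<^sup>2 < (r x)\<^sup>2" by (simp add: power_strict_mono)
    then have "0 < flat 0 ((r x)\<^sup>2 - (norm (p - x))\<^sup>2)" by (simp add: flat_pos_iff)
    then show ?thesis
      unfolding S_def using x(1) D(2) by (intro sum_pos2[of D x]) (auto simp: flat_nonneg)
  qed
  have S_zero: "S p = 0" if "p \<notin> (\<Union>x\<in>D. cball x (r x))" for p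
    unfolding S_def
  proof (rule sum.neutral, safe)
    fix x assume x: "x \<in> D"
    then have "r x < norm (p - x)" using that by (auto simp: dist_norm norm_minus_commute)
    then have "(r x)\<^sup>2 \<le> (norm (p - x))\<^sup>2"
      using r(1)[of x] x D(1) by (intro power_mono) auto
    then show "flat 0 ((r x)\<^sup>2 - (norm (p - x))\<^sup>2) = 0" by (simp add: flat_eq_0_iff)
  qed
  obtain d where d: "0 < d" "\<And>p. p \<in> K \<Longrightarrow> d \<le> S p"
  proof (cases "K = {}")
    case False
    obtain x where "x \<in> K" "\<forall>y\<in>K. S x \<le> S y"
      using continuous_attains_inf[OF K False continuous_on_subset[OF Ck_continuous[OF S_smooth]]]
      by auto
    then show ?thesis using that[of "S x"] S_pos by auto
  qed (use that[of 1] in auto)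
  \<comment> \<open>The factor \<open>2 / d\<close> gives \<open>s p \<ge> 2\<close> on
    \<open>K\<close>, so the open set where \<open>s\<close> exceeds 1 contains
    \<open>K\<close>.\<close>
  define s where "s p = 2 / d * S p" for p
  \<comment> \<open>The classical smooth step: 0 for \<open>s p \<le> 0\<close> and 1 for
    \<open>s p \<ge> 1\<close>. The denominator never vanishes because \<open>s p\<close> and
    \<open>1 - s p\<close> cannot both be nonpositive.\<close>
  define g where "g p = inverse (flat 0 (s p) + flat 0 (1 - s p)) * flat 0 (s p)" for p
  have s_smooth: "Ck k s" for k unfolding s_def by (intro Ck_cmult S_smooth)
  have pos: "0 < flat 0 (s p) + flat 0 (1 - s p)" for p
    using flat_pos_iff[of 0 "s p"] flat_pos_iff[of 0 "1 - s p"]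
      flat_nonneg[of 0 "s p"] flat_nonneg[of 0 "1 - s p"]
    by (cases "0 < s p") (auto intro: add_pos_nonneg add_nonneg_pos)
  show thesis
  proof (rule that[of g "s -` {1<..}"])
    show "g \<in> test_functions V"
    proof (rule test_functionsI[where K = "\<Union>x\<in>D. cball x (r x)"])
      show "Ck k g" for k
        unfolding g_def using pos
        by (intro Ck_mult Ck_inverse Ck_add Ck_flat Ck_diff Ck_const s_smooth) (auto simp: less_le)
      show "g p = 0" if "p \<notin> (\<Union>x\<in>D. cball x (r x))" for p
        using S_zero[OF that] by (simp add: g_def s_def flat_def)
      show "(\<Union>x\<in>D. cball x (r x)) \<subseteq> V" using D(1) r(2) by blast
    qed (use D in auto)
    show "0 \<le> g p" "g p \<le> 1" for p
      using pos[of p] flat_nonneg[of 0 "s p"] flat_nonneg[of 0 "1 - s p"]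
      by (auto simp: g_def field_simps)
    show "open (s -` {1<..})"
      by (rule open_vimage[OF _ Ck_continuous[OF s_smooth]]) auto
    show "K \<subseteq> s -` {1<..}" using d by (auto simp: s_def field_simps) (smt (verit, best))
    show "g p = 1" if "p \<in> s -` {1<..}" for p
    proof -
      have "flat 0 (1 - s p) = 0" using that by (simp add: flat_eq_0_iff)
      then show ?thesis using pos[of p] by (simp add: g_def)
    qed
  qed
qed

section \<open>Riesz representation of positive distributions\<close>

text \<open>Stated as a locale so that the same estimates serve an abstract functional, the integral
  against the measure built from it, and finally \<open>defect\<close>.\<close>

locale positive_distribution =
  fixes U :: "'a::euclidean_space set" and T :: "('a \<Rightarrow> real) \<Rightarrow> real"
  assumes open_U: "open U"
    and T_add: "f \<in> test_functions U \<Longrightarrow> g \<in> test_functions U \<Longrightarrow> T (\<lambda>p. f p + g p) = T f + T g"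
    and T_cmult: "f \<in> test_functions U \<Longrightarrow> T (\<lambda>p. r * f p) = r * T f"
    and T_nonneg: "f \<in> test_functions U \<Longrightarrow> (\<And>p. 0 \<le> f p) \<Longrightarrow> 0 \<le> T f"
begin

lemma T_zero: "T (\<lambda>p. 0) = 0"
  using T_cmult[OF test_functions_zero, of 0] by simp

lemma T_diff:
  "f \<in> test_functions U \<Longrightarrow> g \<in> test_functions U \<Longrightarrow> T (\<lambda>p. f p - g p) = T f - T g"
  using T_add[of f "\<lambda>p. -1 * g p"] T_cmult[of g "-1"] test_functions_cmult[of g U "-1"] by simp

lemma T_mono:
  "f \<in> test_functions U \<Longrightarrow> g \<in> test_functions U \<Longrightarrow> (\<And>p. f p \<le> g p) \<Longrightarrow> T f \<le> T g"
  using T_nonneg[OF test_functions_diff, of g f] T_diff[of g f] by simp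

lemma T_sum:
  "finite I \<Longrightarrow> (\<And>i. i \<in> I \<Longrightarrow> f i \<in> test_functions U) \<Longrightarrow>
    T (\<lambda>p. \<Sum>i\<in>I. f i p) = (\<Sum>i\<in>I. T (f i))"
  by (induction rule: finite_induct) (auto simp: T_zero T_add test_functions_sum)

text \<open>A nonnegative \<open>f\<close> differs by at most \<open>\<delta>\<close> from \<open>\<delta> (\<Sum>k. d k)\<close> when \<open>d k\<close> is a cut-off between the
  superlevel sets \<open>{f \<ge> (k + 1) \<delta>}\<close> and \<open>{f > k \<delta>}\<close>. With \<open>a k\<close> the measure of \<open>{f > k \<delta>}\<close>, the lemma
  applies both to \<open>T\<close> and to integration against the Riesz measure, and thus compares the two.\<close>

lemma T_layer_cake:
  assumes f: "f \<in> test_functions U" and \<delta>: "0 < \<delta>"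
    and d: "\<And>k. d k \<in> test_functions U" "\<And>k p. 0 \<le> d k p" "\<And>k p. d k p \<le> 1"
    and d0: "\<And>k p. f p \<le> real k * \<delta> \<Longrightarrow> d k p = 0"
    and d1: "\<And>k p. real (Suc k) * \<delta> \<le> f p \<Longrightarrow> d k p = 1"
    and n: "\<And>p. f p \<le> real n * \<delta>" and f0: "\<And>p. 0 \<le> f p"
    and G: "G \<in> test_functions U" "\<And>p. 0 \<le> G p" "\<And>p. p \<in> supp f \<Longrightarrow> G p = 1"
    and a: "\<And>k. T (d k) \<le> a k" "\<And>k. a (Suc k) \<le> T (d k)" "\<And>k::nat. 0 \<le> a k"
  shows "\<bar>T f - \<delta> * (\<Sum>k<n. a k)\<bar> \<le> \<delta> * (T G + a 0)"
proof -
  have approx: "\<bar>f p - \<delta> * (\<Sum>k<n. d k p)\<bar> \<le> \<delta> * G p" for p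
  proof (cases "f p = 0")
    case True
    then have "d k p = 0" for k using d0[of p k] \<delta> by simp
    then show ?thesis using True \<delta> G(2)[of p] by simp
  next
    case False
    then have G1: "G p = 1" using G(3) not_in_supp by blast
    \<comment> \<open>\<open>j\<close> is the layer containing the value \<open>f p\<close>: lower
      cut-offs are 1 at \<open>p\<close>, higher ones are 0, and only \<open>d j p\<close> is
      undetermined, which costs at most \<delta>.\<close>
    define j where "j = nat \<lfloor>f p / \<delta>\<rfloor>"
    have "0 \<le> f p / \<delta>" using f0[of p] \<delta> by simp
    then have "real j \<le> f p / \<delta>" "f p / \<delta> < real j + 1"
      unfolding j_def by linarith+
    then have j: "real j * \<delta> \<le> f p" "f p < real (Suc j) * \<delta>"
      using \<delta> by (simp_all add: field_simps)
    have lo: "d k p = 1" if "k < j" for k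
    proof (rule d1)
      have "real (Suc k) * \<delta> \<le> real j * \<delta>" using that \<delta> by (intro mult_right_mono) auto
      then show "real (Suc k) * \<delta> \<le> f p" using j by simp
    qed
    have hi: "d k p = 0" if "j < k" for k
    proof (rule d0)
      have "real (Suc j) * \<delta> \<le> real k * \<delta>" using that \<delta> by (intro mult_right_mono) auto
      then show "f p \<le> real k * \<delta>" using j by simp
    qed
    have "real j * \<delta> \<le> real n * \<delta>" using j(1) n[of p] by simp
    then have "j \<le> n" using \<delta> by simp
    then consider "j < n" | "j = n" by linarith
    then have "\<bar>f p - \<delta> * (\<Sum>k<n. d k p)\<bar> \<le> \<delta>"
    proof cases
      case 1
      have "{..<n} = {..<j} \<union> {j} \<union> {j<..<n}" using 1 by auto
      then have "(\<Sum>k<n. d k p) = (\<Sum>k\<in>{..<j} \<union> {j} \<union> {j<..<n}. d k p)" by simp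
      also have "\<dots> = (\<Sum>k<j. d k p) + d j p + (\<Sum>k\<in>{j<..<n}. d k p)"
        by (subst sum.union_disjoint) (auto simp: sum.union_disjoint)
      also have "\<dots> = real j + d j p" using lo hi by simp
      finally have "\<delta> * (\<Sum>k<n. d k p) = real j * \<delta> + \<delta> * d j p"
        by (simp add: algebra_simps)
      moreover have "\<delta> * d j p \<le> \<delta>" "0 \<le> \<delta> * d j p"
        using d(2,3)[where k=j and p=p] \<delta> by simp_all
      moreover have "f p < real j * \<delta> + \<delta>" using j(2) by (simp add: algebra_simps)
      ultimately show ?thesis using j(1) by linarith
    next
      \<comment> \<open>At the top layer no undetermined cut-off is left in the sum, and the bound
        \<open>n\<close> forces \<open>f p = real n * \<delta>\<close>.\<close>
      case 2
      then have "(\<Sum>k<n. d k p) = real n" using lo by simp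
      moreover have "f p = real n * \<delta>" using 2 j n[of p] by (simp add: antisym)
      ultimately show ?thesis using \<delta> by (simp add: algebra_simps)
    qed
    then show ?thesis using G1 by simp
  qed
  have S: "(\<lambda>p. \<delta> * (\<Sum>k<n. d k p)) \<in> test_functions U"
    by (intro test_functions_cmult test_functions_sum d) simp
  have TS: "T (\<lambda>p. \<delta> * (\<Sum>k<n. d k p)) = \<delta> * (\<Sum>k<n. T (d k))"
    using d by (simp add: T_cmult test_functions_sum T_sum)
  have "T f - \<delta> * (\<Sum>k<n. T (d k)) \<le> T (\<lambda>p. \<delta> * G p)"
    unfolding TS[symmetric] T_diff[OF f S, symmetric]
    by (intro T_mono test_functions_diff f S test_functions_cmult G abs_le_D1[OF approx])
  moreover have "\<delta> * (\<Sum>k<n. T (d k)) - T f \<le> T (\<lambda>p. \<delta> * G p)"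
    unfolding TS[symmetric] T_diff[OF S f, symmetric]
    by (intro T_mono test_functions_diff f S test_functions_cmult G)
      (use abs_le_D2[OF approx] in simp)
  ultimately have 1: "\<bar>T f - \<delta> * (\<Sum>k<n. T (d k))\<bar> \<le> \<delta> * T G"
    using T_cmult[OF G(1)] by (simp add: abs_le_iff)
  have up: "(\<Sum>k<n. T (d k)) \<le> (\<Sum>k<n. a k)" by (intro sum_mono a)
  \<comment> \<open>The upper sum over \<open>a k\<close> and the lower sum over
    \<open>a (Suc k)\<close> enclose the sum of the \<open>T (d k)\<close>; shifting the index shows
    that the two differ by at most \<open>a 0\<close>.\<close>
  have "(\<Sum>k<n. a k) - a 0 \<le> (\<Sum>k<n. a (Suc k))"
  proof -
    have "(\<Sum>k<n. a k) \<le> (\<Sum>k<Suc n. a k)" using a(3)[of n] by simp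
    also have "\<dots> = a 0 + (\<Sum>k<n. a (Suc k))" by (rule sum.lessThan_Suc_shift)
    finally show ?thesis by simp
  qed
  also have "\<dots> \<le> (\<Sum>k<n. T (d k))" by (intro sum_mono a)
  finally have "\<bar>(\<Sum>k<n. T (d k)) - (\<Sum>k<n. a k)\<bar> \<le> a 0" using up a(3)[of 0] by simp
  then have 2: "\<bar>\<delta> * (\<Sum>k<n. T (d k)) - \<delta> * (\<Sum>k<n. a k)\<bar> \<le> \<delta> * a 0"
    using \<delta> by (simp add: right_diff_distrib[symmetric] abs_mult)
  from 1 2 show ?thesis by (simp add: algebra_simps)
qed

section \<open>From the functional to an outer measure\<close>

definition unit_tests :: "'a set \<Rightarrow> ('a \<Rightarrow> real) set" where
  "unit_tests V = {f \<in> test_functions V. \<forall>p. 0 \<le> f p \<and> f p \<le> 1}"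

definition open_mass :: "'a set \<Rightarrow> ennreal" where
  "open_mass V = (SUP f\<in>unit_tests V. ennreal (T f))"

text \<open>Outer regularity is built into the definition. The constraint
  \<open>V \<subseteq> U\<close> keeps every competing test function in the domain of
  \<open>T\<close>.\<close>

definition outer_mass :: "'a set \<Rightarrow> ennreal" where
  "outer_mass A = (INF V\<in>{V. open V \<and> A \<subseteq> V \<and> V \<subseteq> U}. open_mass V)"

lemma zero_in_unit_tests: "(\<lambda>p. 0) \<in> unit_tests V"
  by (simp add: unit_tests_def test_functions_zero)

lemma unit_tests_mono: "V \<subseteq> W \<Longrightarrow> unit_tests V \<subseteq> unit_tests W"
  using test_functions_mono by (auto simp: unit_tests_def)

lemma unit_tests_T_nonneg: "f \<in> unit_tests U \<Longrightarrow> 0 \<le> T f"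
  by (auto simp: unit_tests_def intro: T_nonneg)

lemma T_le_open_mass: "f \<in> unit_tests V \<Longrightarrow> ennreal (T f) \<le> open_mass V"
  unfolding open_mass_def by (rule SUP_upper)

lemma open_mass_mono: "V \<subseteq> W \<Longrightarrow> open_mass V \<le> open_mass W"
  unfolding open_mass_def by (rule SUP_subset_mono[OF unit_tests_mono]) auto

lemma open_mass_empty: "open_mass {} = 0"
proof -
  have "f = (\<lambda>p. 0)" if "f \<in> unit_tests {}" for f
    using that by (auto simp: unit_tests_def test_functions_iff not_in_supp)
  then have "ennreal (T f) = 0" if "f \<in> unit_tests {}" for f
    using that T_zero by fastforce
  then show ?thesis by (auto simp: open_mass_def intro!: SUP_eq_const antisym SUP_least)
qed

text \<open>A two-piece partition of unity: with \<open>g = 1\<close> near the part of the support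
  outside \<open>W\<close>, the summand \<open>f g\<close> is supported in \<open>V\<close> and
  \<open>(1 - g) f\<close> in \<open>W\<close>.\<close>

lemma open_mass_Un:
  assumes V: "open V" "V \<subseteq> U" and W: "open W" "W \<subseteq> U"
  shows "open_mass (V \<union> W) \<le> open_mass V + open_mass W"
  unfolding open_mass_def[of "V \<union> W"]
proof (rule SUP_least)
  fix f assume f: "f \<in> unit_tests (V \<union> W)"
  then have f': "f \<in> test_functions (V \<union> W)" "\<And>p. 0 \<le> f p" "\<And>p. f p \<le> 1"
    by (auto simp: unit_tests_def)
  then have s: "compact (supp f)" "supp f \<subseteq> V \<union> W" by (auto simp: test_functions_iff)
  have "compact (supp f - W)" using s W by (simp add: compact_diff)
  moreover have "supp f - W \<subseteq> V" using s by auto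
  ultimately obtain g N where g: "g \<in> test_functions V" "\<And>p. 0 \<le> g p" "\<And>p. g p \<le> 1"
      "open N" "supp f - W \<subseteq> N" "\<And>p. p \<in> N \<Longrightarrow> g p = 1"
    using smooth_Urysohn[OF _ V(1)] by metis
  have gs: "Ck k g" "Ck k f" for k using g(1) f'(1) by (auto simp: test_functions_iff)
  have 1: "(\<lambda>p. f p * g p) \<in> unit_tests V"
    using test_functions_mult[OF g(1) gs(2)] f' g
    by (auto simp: unit_tests_def mult_le_one)
  have "(\<lambda>p. (1 - g p) * f p) \<in> test_functions W"
  \<comment> \<open>Removing the open set \<open>N\<close> keeps the set compact, and it lies in
    \<open>W\<close> because \<open>N\<close> covers \<open>supp f - W\<close>. This needs
    \<open>g = 1\<close> on a whole neighbourhood.\<close>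
  proof (rule test_functionsI[where K = "supp f - N"])
    show "Ck k (\<lambda>p. (1 - g p) * f p)" for k
      by (intro Ck_mult Ck_diff Ck_const gs)
    show "compact (supp f - N)" by (rule compact_diff[OF s(1) g(4)])
    show "supp f - N \<subseteq> W" using g(5) by blast
    show "(1 - g p) * f p = 0" if "p \<notin> supp f - N" for p
      using that g(6)[of p] not_in_supp[of p f] by (cases "p \<in> N") auto
  qed
  then have 2: "(\<lambda>p. (1 - g p) * f p) \<in> unit_tests W"
    using f' g by (auto simp: unit_tests_def mult_le_one)
  have U: "(\<lambda>p. f p * g p) \<in> unit_tests U" "(\<lambda>p. (1 - g p) * f p) \<in> unit_tests U"
    using 1 2 unit_tests_mono[OF V(2)] unit_tests_mono[OF W(2)] by blast+
  have "T f = T (\<lambda>p. f p * g p + (1 - g p) * f p)"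
    by (rule arg_cong[where f = T]) (auto simp: algebra_simps)
  also have "\<dots> = T (\<lambda>p. f p * g p) + T (\<lambda>p. (1 - g p) * f p)"
    using U by (intro T_add) (auto simp: unit_tests_def)
  finally have "ennreal (T f) = ennreal (T (\<lambda>p. f p * g p)) + ennreal (T (\<lambda>p. (1 - g p) * f p))"
    using U by (simp add: unit_tests_T_nonneg)
  also have "\<dots> \<le> open_mass V + open_mass W"
    by (intro add_mono T_le_open_mass 1 2)
  finally show "ennreal (T f) \<le> open_mass V + open_mass W" .
qed

lemma open_mass_UN_lessThan:
  assumes "\<And>i::nat. open (V i)" "\<And>i. V i \<subseteq> U"
  shows "open_mass (\<Union>i<n. V i) \<le> (\<Sum>i<n. open_mass (V i))"
proof (induction n)
  case (Suc n)
  have "open_mass (\<Union>i<Suc n. V i) = open_mass ((\<Union>i<n. V i) \<union> V n)"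
    by (simp add: lessThan_Suc Un_commute)
  also have "\<dots> \<le> open_mass (\<Union>i<n. V i) + open_mass (V n)"
    using assms by (intro open_mass_Un) auto
  finally show ?case using Suc by (auto intro: order_trans add_right_mono)
qed (simp add: open_mass_empty)

text \<open>The support of a single test function is compact and so meets the union through finitely
  many of the sets, which reduces to finite subadditivity.\<close>

lemma open_mass_UN:
  assumes V: "\<And>i::nat. open (V i)" "\<And>i. V i \<subseteq> U"
  shows "open_mass (\<Union>i. V i) \<le> (\<Sum>i. open_mass (V i))"
  unfolding open_mass_def[of "\<Union>i. V i"]
proof (rule SUP_least)
  fix f assume f: "f \<in> unit_tests (\<Union>i. V i)"
  then have s: "compact (supp f)" "supp f \<subseteq> (\<Union>i. V i)"
    by (auto simp: unit_tests_def test_functions_iff)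
  obtain C where C: "finite C" "supp f \<subseteq> (\<Union>i\<in>C. V i)"
    using compactE_image[OF s(1), of UNIV V] V s(2) by auto
  then obtain n where "C \<subseteq> {..<n}" using finite_nat_bounded by blast
  then have "supp f \<subseteq> (\<Union>i<n. V i)" using C(2) by blast
  then have "f \<in> unit_tests (\<Union>i<n. V i)"
    using f by (auto simp: unit_tests_def test_functions_iff)
  then have "ennreal (T f) \<le> open_mass (\<Union>i<n. V i)" by (rule T_le_open_mass)
  also have "\<dots> \<le> (\<Sum>i<n. open_mass (V i))" by (rule open_mass_UN_lessThan[OF V])
  also have "\<dots> \<le> (\<Sum>i. open_mass (V i))" by (rule sum_le_suminf) auto
  finally show "ennreal (T f) \<le> (\<Sum>i. open_mass (V i))" .
qed

lemma outer_mass_open: "open V \<Longrightarrow> V \<subseteq> U \<Longrightarrow> outer_mass V = open_mass V"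
  unfolding outer_mass_def
  by (rule antisym) (auto intro!: INF_lower INF_greatest open_mass_mono)

lemma outer_mass_mono: "A \<subseteq> B \<Longrightarrow> outer_mass A \<le> outer_mass B"
  unfolding outer_mass_def by (rule INF_superset_mono) auto

lemma outer_mass_less:
  "outer_mass A < x \<Longrightarrow> \<exists>V. open V \<and> A \<subseteq> V \<and> V \<subseteq> U \<and> open_mass V < x"
  unfolding outer_mass_def INF_less_iff by blast

lemma outer_mass_outer_measure: "outer_measure_space (Pow U) outer_mass"
  unfolding outer_measure_space_def
proof (intro conjI)
  show "positive (Pow U) outer_mass"
    by (simp add: positive_def outer_mass_open open_mass_empty)
  show "increasing (Pow U) outer_mass"
    by (simp add: increasing_def outer_mass_mono)
  show "countably_subadditive (Pow U) outer_mass"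
    unfolding countably_subadditive_def
  proof safe
    fix A :: "nat \<Rightarrow> 'a set" assume A: "range A \<subseteq> Pow U"
    show "outer_mass (\<Union>i. A i) \<le> (\<Sum>i. outer_mass (A i))"
    proof (rule ennreal_le_epsilon)
      fix e :: real assume e: "0 < e" and fin: "(\<Sum>i. outer_mass (A i)) < top"
      \<comment> \<open>The excesses \<open>e / 2 ^ Suc n\<close> add up to \<open>e\<close>.
        Strictness requires each outer mass to be finite, which finiteness of the sum
        guarantees.\<close>
      have "outer_mass (A n) < outer_mass (A n) + ennreal (e * (1/2) ^ Suc n)" for n
        using fin e by (auto simp: less_top dest!: ennreal_suminf_lessD)
      then have "\<exists>V. open V \<and> A n \<subseteq> V \<and> V \<subseteq> U \<and>
          open_mass V \<le> outer_mass (A n) + ennreal (e * (1/2) ^ Suc n)" for n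
        using outer_mass_less by (meson less_imp_le)
      then obtain V where V: "\<And>n. open (V n)" "\<And>n. A n \<subseteq> V n" "\<And>n. V n \<subseteq> U"
          "\<And>n. open_mass (V n) \<le> outer_mass (A n) + ennreal (e * (1/2) ^ Suc n)"
        by metis
      have "outer_mass (\<Union>i. A i) \<le> open_mass (\<Union>i. V i)"
        unfolding outer_mass_def by (rule INF_lower) (use V in \<open>auto, blast\<close>)
      also have "\<dots> \<le> (\<Sum>i. open_mass (V i))" by (rule open_mass_UN[OF V(1,3)])
      also have "\<dots> \<le> (\<Sum>n. outer_mass (A n) + ennreal (e * (1/2) ^ Suc n))"
        by (intro suminf_le V(4)) auto
      also have "\<dots> = (\<Sum>n. outer_mass (A n)) + (\<Sum>n. ennreal e * ennreal ((1/2) ^ Suc n))"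
        using e by (subst suminf_add[symmetric])
          (auto simp del: ennreal_suminf_cmult simp add: ennreal_mult[symmetric])
      also have "\<dots> = (\<Sum>n. outer_mass (A n)) + ennreal e"
        unfolding ennreal_suminf_cmult
        by (subst suminf_ennreal_eq[OF zero_le_power power_half_series]) auto
      finally show "outer_mass (\<Union>i. A i) \<le> (\<Sum>i. outer_mass (A i)) + ennreal e" .
    qed
  qed
qed

text \<open>For a unit test \<open>f\<close> on \<open>W \<inter> V\<close>, the open set
  \<open>W - supp f\<close> contains \<open>W - V\<close>. A unit test \<open>g\<close> there has
  support disjoint from that of \<open>f\<close>, so \<open>f + g\<close> is still bounded by 1 and
  competes for \<open>open_mass W\<close>. Suprema over \<open>g\<close>, then over
  \<open>f\<close>, give the claim.\<close>

lemma outer_mass_split: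
  assumes V: "open V" "V \<subseteq> U" and W: "open W" "W \<subseteq> U"
  shows "open_mass (W \<inter> V) + outer_mass (W - V) \<le> open_mass W"
proof -
  have "ennreal (T f) + outer_mass (W - V) \<le> open_mass W" if f: "f \<in> unit_tests (W \<inter> V)" for f
  proof -
    have s: "compact (supp f)" "supp f \<subseteq> W \<inter> V" and fU: "f \<in> unit_tests U"
      using f V unit_tests_mono[of "W \<inter> V" U] by (auto simp: unit_tests_def test_functions_iff)
    have "outer_mass (W - V) \<le> open_mass (W - supp f)"
      unfolding outer_mass_def by (rule INF_lower) (use s W in \<open>auto intro: open_Diff\<close>)
    moreover have "ennreal (T f) + open_mass (W - supp f) \<le> open_mass W"
      unfolding open_mass_def[of "W - supp f"]
    proof (subst ennreal_SUP_add_right)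
      show "unit_tests (W - supp f) \<noteq> {}" using zero_in_unit_tests by blast
      show "(SUP g\<in>unit_tests (W - supp f). ennreal (T f) + ennreal (T g)) \<le> open_mass W"
      proof (rule SUP_least)
        fix g assume g: "g \<in> unit_tests (W - supp f)"
        then have gU: "g \<in> unit_tests U" and gs: "supp g \<subseteq> W - supp f"
          using W unit_tests_mono[of "W - supp f" U]
          by (auto simp: unit_tests_def test_functions_iff)
        have fg: "f p = 0 \<or> g p = 0" for p
          using gs not_in_supp[of p f] not_in_supp[of p g] by auto
        have "f \<in> test_functions W" "g \<in> test_functions W"
          using f g s(2) gs by (auto simp: unit_tests_def test_functions_iff)
        then have "(\<lambda>p. f p + g p) \<in> test_functions W" by (rule test_functions_add)
        moreover have "0 \<le> f p + g p \<and> f p + g p \<le> 1" for p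
          using fg[of p] f g by (auto simp: unit_tests_def)
        ultimately have "ennreal (T (\<lambda>p. f p + g p)) \<le> open_mass W"
          by (intro T_le_open_mass) (simp add: unit_tests_def)
        moreover have "T (\<lambda>p. f p + g p) = T f + T g"
          using fU gU by (intro T_add) (auto simp: unit_tests_def)
        ultimately show "ennreal (T f) + ennreal (T g) \<le> open_mass W"
          using fU gU by (simp add: unit_tests_T_nonneg flip: ennreal_plus)
      qed
    qed
    ultimately show ?thesis by (meson add_left_mono order_trans)
  qed
  then show ?thesis
    unfolding open_mass_def[of "W \<inter> V"]
    by (subst ennreal_SUP_add_left[symmetric])
      (use zero_in_unit_tests in \<open>auto intro!: SUP_least\<close>)
qed

text \<open>Caratheodory's criterion: the hard inequality is \<open>outer_mass_split\<close> for
  open \<open>W\<close> around \<open>A\<close>, followed by the infimum over \<open>W\<close>; the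
  other one is subadditivity.\<close>

lemma open_in_lambda_system:
  assumes V: "open V" "V \<subseteq> U"
  shows "V \<in> lambda_system U (Pow U) outer_mass"
proof -
  interpret sigma_algebra U "Pow U" by (rule sigma_algebra_Pow)
  have "outer_mass (A \<inter> V) + outer_mass (A - V) = outer_mass A" if A: "A \<subseteq> U" for A
  proof (rule antisym)
    show "outer_mass (A \<inter> V) + outer_mass (A - V) \<le> outer_mass A"
      unfolding outer_mass_def[of A]
    proof (rule INF_greatest)
      fix W assume "W \<in> {V. open V \<and> A \<subseteq> V \<and> V \<subseteq> U}"
      then have W: "open W" "A \<subseteq> W" "W \<subseteq> U" by auto
      have "outer_mass (A \<inter> V) \<le> open_mass (W \<inter> V)"
        unfolding outer_mass_def by (rule INF_lower) (use W V in auto)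
      moreover have "outer_mass (A - V) \<le> outer_mass (W - V)"
        using W by (intro outer_mass_mono) auto
      ultimately show "outer_mass (A \<inter> V) + outer_mass (A - V) \<le> open_mass W"
        using outer_mass_split[OF V W(1,3)] by (meson add_mono order_trans)
    qed
    have "subadditive (Pow U) outer_mass"
      using outer_mass_outer_measure
      by (auto simp: outer_measure_space_def intro: countably_subadditive_subadditive)
    from subadditiveD[OF this, of "A \<inter> V" "A - V"] A
    show "outer_mass A \<le> outer_mass (A \<inter> V) + outer_mass (A - V)"
      by (auto simp: Int_Diff_Un)
  qed
  then show ?thesis using V by (simp add: lambda_system_eq)
qed

section \<open>The Riesz measure on Borel subsets of the domain\<close>

definition riesz_measure :: "'a measure" where
  "riesz_measure = measure_of U (sets (restrict_space borel U)) outer_mass"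

text \<open>The Caratheodory measurable sets form a sigma-algebra, and the traces of open sets on
  \<open>U\<close>, which generate the left-hand side, belong to it.\<close>

lemma restrict_borel_lambda_system:
  "sets (restrict_space borel U) \<subseteq> lambda_system U (Pow U) outer_mass"
proof -
  have "measure_space U (lambda_system U (Pow U) outer_mass) outer_mass"
    by (rule sigma_algebra.caratheodory_lemma[OF sigma_algebra_Pow outer_mass_outer_measure])
  then interpret L: sigma_algebra U "lambda_system U (Pow U) outer_mass"
    by (simp add: measure_space_def)
  have "sets (restrict_space borel U) = (\<inter>) U ` sigma_sets UNIV {S. open S}"
    by (simp add: sets_restrict_space borel_def)
  also have "\<dots> = sigma_sets U ((\<inter>) U ` {S. open S})"
    by (rule sigma_sets_Int) (auto simp: open_U)
  also have "\<dots> \<subseteq> lambda_system U (Pow U) outer_mass"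
    by (rule L.sigma_sets_subset) (auto intro!: open_in_lambda_system open_Int open_U)
  finally show ?thesis .
qed

lemma
  shows space_riesz_measure [simp]: "space riesz_measure = U"
    and sets_riesz_measure: "sets riesz_measure = sets (restrict_space borel U)"
    and emeasure_riesz_measure:
      "A \<in> sets (restrict_space borel U) \<Longrightarrow> emeasure riesz_measure A = outer_mass A"
proof -
  let ?B = "sets (restrict_space borel U)"
  have sp: "space (restrict_space borel U) = U" by (simp add: space_restrict_space)
  have B: "sigma_algebra U ?B"
    using sets.sigma_algebra_axioms[of "restrict_space borel U"] by (simp only: sp)
  have "?B \<subseteq> Pow U" using sigma_algebra.axioms(1)[OF B] by (simp add: algebra_iff_Un)
  then show "space riesz_measure = U" "sets riesz_measure = ?B"
    using sigma_algebra.sigma_sets_eq[OF B] by (simp_all add: riesz_measure_def)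
  have L: "measure_space U (lambda_system U (Pow U) outer_mass) outer_mass"
    by (rule sigma_algebra.caratheodory_lemma[OF sigma_algebra_Pow outer_mass_outer_measure])
  then have "positive ?B outer_mass" "countably_additive ?B outer_mass"
    using restrict_borel_lambda_system
    unfolding measure_space_def positive_def countably_additive_def by blast+
  then show "emeasure riesz_measure A = outer_mass A" if "A \<in> ?B"
    unfolding riesz_measure_def using B that by (intro emeasure_measure_of_sigma)
qed

lemma in_sets_riesz_measure: "A \<in> sets borel \<Longrightarrow> A \<subseteq> U \<Longrightarrow> A \<in> sets riesz_measure"
  using open_U by (auto simp: sets_riesz_measure sets_restrict_space_iff)

lemma T_le_riesz_measure:
  assumes "open V" "V \<subseteq> U" "f \<in> unit_tests V"
  shows "ennreal (T f) \<le> emeasure riesz_measure V"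
  using assms T_le_open_mass[of f V] in_sets_riesz_measure[of V]
  by (simp add: sets_riesz_measure emeasure_riesz_measure outer_mass_open)

text \<open>Every unit test on \<open>W \<inter> U\<close> lies below \<open>g\<close>: it is at
  most 1 on \<open>W\<close> and 0 elsewhere. Hence the mass of this open set around
  \<open>A\<close> is at most \<open>T g\<close>.\<close>

lemma riesz_measure_le_T:
  assumes "open W" "A \<subseteq> W" "A \<subseteq> U" "A \<in> sets borel"
    and g: "g \<in> test_functions U" "\<And>p. 0 \<le> g p" "\<And>p. p \<in> W \<Longrightarrow> g p = 1"
  shows "emeasure riesz_measure A \<le> ennreal (T g)"
proof -
  have "emeasure riesz_measure A = outer_mass A"
    using assms in_sets_riesz_measure[of A] by (simp add: sets_riesz_measure emeasure_riesz_measure)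
  also have "\<dots> \<le> open_mass (W \<inter> U)"
    unfolding outer_mass_def by (rule INF_lower) (use assms open_U in auto)
  also have "\<dots> \<le> ennreal (T g)"
    unfolding open_mass_def
  proof (rule SUP_least)
    fix f assume f: "f \<in> unit_tests (W \<inter> U)"
    then have fU: "f \<in> unit_tests U" using unit_tests_mono[of "W \<inter> U" U] by auto
    have "f p \<le> g p" for p
    proof (cases "p \<in> W")
      case True
      then show ?thesis using fU g(3) by (simp add: unit_tests_def)
    next
      case False
      then have "f p = 0"
        using f by (intro not_in_supp) (auto simp: unit_tests_def test_functions_iff)
      then show ?thesis using g(2) by simp
    qed
    then have "T f \<le> T g" using fU g(1) by (intro T_mono) (auto simp: unit_tests_def)
    then show "ennreal (T f) \<le> ennreal (T g)" by (rule ennreal_leI)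
  qed
  finally show ?thesis .
qed

lemma riesz_measure_compact_finite:
  assumes "compact K" "K \<subseteq> U"
  shows "emeasure riesz_measure K < \<infinity>"
proof -
  obtain g W where "g \<in> test_functions U" "\<And>p. 0 \<le> g p" "\<And>p. g p \<le> 1"
      "open W" "K \<subseteq> W" "\<And>p. p \<in> W \<Longrightarrow> g p = 1"
    using smooth_Urysohn[OF assms(1) open_U assms(2)] by metis
  then have "emeasure riesz_measure K \<le> ennreal (T g)"
    using assms by (intro riesz_measure_le_T) (auto simp: borel_compact)
  then show ?thesis using ennreal_less_top[of "T g"] by (simp add: le_less_trans less_top)
qed

lemma riesz_measure_radon: "radon_measure_on U riesz_measure"
  using riesz_measure_compact_finite by (simp add: radon_measure_on_def sets_riesz_measure)

section \<open>Identification of the functional with the integral\<close>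

lemma integrable_riesz_measure:
  assumes f: "f \<in> test_functions U"
  shows "integrable riesz_measure f"
proof -
  have s: "compact (supp f)" "supp f \<subseteq> U" using f by (auto simp: test_functions_iff)
  obtain C where C: "0 \<le> C" "\<And>p. \<bar>f p\<bar> \<le> C" using test_functions_bounded[OF f] by metis
  have "f \<in> borel_measurable borel"
    by (rule borel_measurable_continuous_onI[OF test_functions_continuous[OF f]])
  then have m: "f \<in> borel_measurable riesz_measure"
    using measurable_cong_sets[OF sets_riesz_measure refl] measurable_restrict_space1 by blast
  have i: "integrable riesz_measure (\<lambda>p. C * indicator (supp f) p)"
    using s riesz_measure_compact_finite[OF s] in_sets_riesz_measure[of "supp f"]
    by (intro integrable_mult_right integrable_real_indicator) (auto simp: borel_closed)
  show ?thesis
    by (rule Bochner_Integration.integrable_bound[OF i m])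
      (use C not_in_supp[of _ f] in \<open>auto simp: indicator_def\<close>)
qed

lemma riesz_integral_positive_distribution:
  "positive_distribution U (\<lambda>f. \<integral>p. f p \<partial>riesz_measure)"
  by unfold_locales (auto simp: open_U integrable_riesz_measure)

text \<open>Both functionals sandwich the same cut-offs between the same numbers \<open>a k\<close>,
  the measures of the superlevel sets. By the layer-cake estimate both values at \<open>f\<close>
  are within a multiple of \<delta> of one common sum, and \<delta> is arbitrary.\<close>

lemma riesz_representation_nonneg:
  assumes f: "f \<in> test_functions U" and f0: "\<And>p. 0 \<le> f p"
  shows "T f = (\<integral>p. f p \<partial>riesz_measure)"
proof -
  let ?m = riesz_measure
  interpret J: positive_distribution U "\<lambda>f. \<integral>p. f p \<partial>?m"
    by (rule riesz_integral_positive_distribution)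
  have s: "compact (supp f)" "supp f \<subseteq> U" using f by (auto simp: test_functions_iff)
  have cont: "continuous_on UNIV f" by (rule test_functions_continuous[OF f])
  obtain G where G: "G \<in> test_functions U" "\<And>p. 0 \<le> G p" "\<And>p. p \<in> supp f \<Longrightarrow> G p = 1"
    using smooth_Urysohn[OF s(1) open_U s(2)] by (metis subsetD)
  obtain C where C: "0 \<le> C" "\<And>p. \<bar>f p\<bar> \<le> C" using test_functions_bounded[OF f] by metis
  define A where "A = measure ?m (supp f)"
  \<comment> \<open>The measure \<open>A\<close> of the support bounds \<open>a 0\<close> for every
    \<delta>; it enters twice, once for each functional, so the bracket does not depend on
    \<delta>.\<close>
  have est: "\<bar>T f - (\<integral>p. f p \<partial>?m)\<bar> \<le> \<delta> * (T G + (\<integral>p. G p \<partial>?m) + 2 * A)" if \<delta>: "0 < \<delta>" for \<delta>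
  proof -
    define V where "V k = {p. real k * \<delta> < f p}" for k
    define K where "K k = {p. real (Suc k) * \<delta> \<le> f p}" for k
    have V_open: "open (V k)" for k
      using open_vimage[OF open_greaterThan cont] by (simp add: V_def vimage_def)
    have V_supp: "V k \<subseteq> supp f" for k
    proof
      fix p assume "p \<in> V k"
      moreover have "0 \<le> real k * \<delta>" using \<delta> by simp
      ultimately have "f p \<noteq> 0" by (auto simp: V_def)
      then show "p \<in> supp f" using not_in_supp by blast
    qed
    have K_V: "K k \<subseteq> V k" for k
    proof -
      have "real k * \<delta> < real (Suc k) * \<delta>" using \<delta> by (intro mult_strict_right_mono) auto
      then show ?thesis by (auto simp: K_def V_def)
    qed
    have V_K: "V (Suc k) \<subseteq> K k" for k by (auto simp: K_def V_def)
    have K_closed: "closed (K k)" for k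
      using closed_vimage[OF closed_atLeast cont] by (simp add: K_def vimage_def)
    have K_compact: "compact (K k)" for k
    proof -
      have "K k = supp f \<inter> K k" using V_supp[of k] K_V[of k] by blast
      then show ?thesis by (metis compact_Int_closed[OF s(1) K_closed])
    qed
    \<comment> \<open>Support inside \<open>V k\<close> yields the upper bound \<open>a k\<close>.
      Being 1 near \<open>K k\<close> yields the lower bound \<open>a (Suc k)\<close>, because
      \<open>V (Suc k) \<subseteq> K k\<close>.\<close>
    have "\<exists>d W. d \<in> test_functions (V k) \<and> (\<forall>p. 0 \<le> d p) \<and> (\<forall>p. d p \<le> 1) \<and>
        open W \<and> K k \<subseteq> W \<and> (\<forall>p\<in>W. d p = 1)" for k
      using smooth_Urysohn[OF K_compact V_open K_V, of k] by (metis (no_types))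
    then obtain d W where d: "\<And>k. d k \<in> test_functions (V k)" "\<And>k p. 0 \<le> d k p"
        "\<And>k p. d k p \<le> 1" "\<And>k. open (W k)" "\<And>k. K k \<subseteq> W k" "\<And>k p. p \<in> W k \<Longrightarrow> d k p = 1"
      by metis
    have dU: "d k \<in> test_functions U" for k
      using d(1)[of k] test_functions_mono[of "V k" U] V_supp[of k] s(2) by blast
    have fin: "emeasure ?m B < \<infinity>" if "B \<subseteq> supp f" for B
    proof -
      have "emeasure ?m B \<le> emeasure ?m (supp f)"
        by (rule emeasure_mono[OF that in_sets_riesz_measure[OF _ s(2)]]) (simp add: borel_closed)
      also have "\<dots> < \<infinity>" by (rule riesz_measure_compact_finite[OF s])
      finally show ?thesis .
    qed
    have V_sets: "V k \<in> sets ?m" and K_sets: "K k \<in> sets ?m" for k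
      using in_sets_riesz_measure[of "V k"] in_sets_riesz_measure[of "K k"] V_open[of k]
        K_closed[of k] V_supp[of k] K_V[of k] s(2) by (auto simp: borel_closed)
    have V_fin: "emeasure ?m (V k) \<noteq> \<infinity>" and K_fin: "emeasure ?m (K k) \<noteq> \<infinity>" for k
      using fin[OF V_supp[of k]] fin[OF order_trans[OF K_V V_supp], of k] by simp_all
    have V_U: "V k \<inter> U = V k" and K_U: "K k \<inter> U = K k" for k
      using V_supp[of k] K_V[of k] s(2) by auto
    define a where "a k = measure ?m (V k)" for k
    have a_K: "a (Suc k) \<le> measure ?m (K k)" for k
      unfolding a_def using V_K[of k] V_sets K_sets K_fin
      by (intro measure_mono_fmeasurable) (auto simp: fmeasurable_def less_top)
    have a_A: "a 0 \<le> A"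
      unfolding a_def A_def using V_sets V_supp in_sets_riesz_measure[of "supp f"] s
        riesz_measure_compact_finite[OF s]
      by (intro measure_mono_fmeasurable) (auto simp: fmeasurable_def less_top borel_closed)
    have Td_le: "T (d k) \<le> a k" for k
    proof -
      have "ennreal (T (d k)) \<le> emeasure ?m (V k)"
        using d V_open V_supp[of k] s(2) by (intro T_le_riesz_measure) (auto simp: unit_tests_def)
      then show ?thesis using V_fin[of k] by (simp add: a_def emeasure_eq_ennreal_measure)
    qed
    have Td_ge: "a (Suc k) \<le> T (d k)" for k
    proof -
      have "emeasure ?m (K k) \<le> ennreal (T (d k))"
        using d K_closed[of k] K_V[of k] V_supp[of k] s(2) dU
        by (intro riesz_measure_le_T[where W = "W k"]) (auto simp: borel_closed)
      then have "measure ?m (K k) \<le> T (d k)"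
        using K_fin[of k] T_nonneg[OF dU, of k] d(2)
        by (simp add: emeasure_eq_ennreal_measure)
      then show ?thesis using a_K[of k] by simp
    qed
    have d_zero: "d k p = 0" if "p \<notin> V k" for k p
      using that d(1)[of k] by (intro not_in_supp) (auto simp: test_functions_iff)
    have Jd_le: "(\<integral>p. d k p \<partial>?m) \<le> a k" for k
    proof -
      have "(\<integral>p. d k p \<partial>?m) \<le> (\<integral>p. indicator (V k) p \<partial>?m)"
        using V_sets[of k] V_fin[of k] d(3)[of k] d_zero[of _ k]
        by (intro integral_mono integrable_riesz_measure dU integrable_real_indicator)
          (auto simp: indicator_def less_top)
      then show ?thesis using V_sets[of k] by (simp add: a_def V_U)
    qed
    have Jd_ge: "a (Suc k) \<le> (\<integral>p. d k p \<partial>?m)" for k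
    proof -
      have "(\<integral>p. indicator (K k) p \<partial>?m) \<le> (\<integral>p. d k p \<partial>?m)"
        using K_sets[of k] K_fin[of k] d(2)[of k] d(6)[of _ k] d(5)[of k]
        by (intro integral_mono integrable_riesz_measure dU integrable_real_indicator)
          (auto simp: indicator_def less_top)
      then show ?thesis using K_sets[of k] a_K[of k] by (simp add: K_U)
    qed
    obtain n :: nat where "C / \<delta> \<le> real n" using real_arch_simple by blast
    then have "C \<le> real n * \<delta>" using \<delta> by (simp add: field_simps)
    then have n: "f p \<le> real n * \<delta>" for p using C(2)[of p] by simp
    have d0: "d k p = 0" if "f p \<le> real k * \<delta>" for k p
      using that by (intro d_zero) (simp add: V_def)
    have d1: "d k p = 1" if "real (Suc k) * \<delta> \<le> f p" for k p
      using that d(5)[of k] d(6)[of p k] by (auto simp: K_def)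
    have "\<bar>T f - \<delta> * (\<Sum>k<n. a k)\<bar> \<le> \<delta> * (T G + a 0)"
      by (rule T_layer_cake[where d = d and n = n and G = G and a = a, OF f \<delta> dU d(2,3) d0 d1 n f0 G Td_le Td_ge]) (auto simp: a_def)
    moreover have "\<bar>(\<integral>p. f p \<partial>?m) - \<delta> * (\<Sum>k<n. a k)\<bar> \<le> \<delta> * ((\<integral>p. G p \<partial>?m) + a 0)"
      by (rule J.T_layer_cake[where d = d and n = n and G = G and a = a, OF f \<delta> dU d(2,3) d0 d1 n f0 G Jd_le Jd_ge]) (auto simp: a_def)
    ultimately have "\<bar>T f - (\<integral>p. f p \<partial>?m)\<bar> \<le> \<delta> * (T G + a 0) + \<delta> * ((\<integral>p. G p \<partial>?m) + a 0)"
      by linarith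
    also have "\<dots> \<le> \<delta> * (T G + (\<integral>p. G p \<partial>?m) + 2 * A)"
      using a_A \<delta> by (simp add: distrib_left[symmetric])
    finally show ?thesis .
  qed
  define B where "B = T G + (\<integral>p. G p \<partial>?m) + 2 * A"
  have "0 \<le> B"
    using T_nonneg[OF G(1,2)] J.T_nonneg[OF G(1,2)] by (simp add: B_def A_def)
  have "\<bar>T f - (\<integral>p. f p \<partial>?m)\<bar> \<le> 0 + e" if "0 < e" for e
  proof -
    \<comment> \<open>Here \<delta> is \<open>e / (B + 1)\<close>; the summand 1 covers the case
      \<open>B = 0\<close>.\<close>
    have "\<bar>T f - (\<integral>p. f p \<partial>?m)\<bar> \<le> e / (B + 1) * B"
      by (rule est[folded B_def]) (use that \<open>0 \<le> B\<close> in auto)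
    also have "\<dots> \<le> e" using that \<open>0 \<le> B\<close> by (simp add: field_simps)
    finally show ?thesis by simp
  qed
  then have "\<bar>T f - (\<integral>p. f p \<partial>?m)\<bar> \<le> 0" by (rule field_le_epsilon)
  then show ?thesis by simp
qed

text \<open>Adding \<open>C * G\<close>, with \<open>G = 1\<close> on the support and
  \<open>C\<close> a bound of \<open>f\<close>, makes \<open>f\<close> nonnegative; the nonnegative
  case then applies to both the sum and the added term.\<close>

theorem riesz_representation:
  assumes f: "f \<in> test_functions U"
  shows "T f = (\<integral>p. f p \<partial>riesz_measure)"
proof -
  have s: "compact (supp f)" "supp f \<subseteq> U" using f by (auto simp: test_functions_iff)
  obtain G where G: "G \<in> test_functions U" "\<And>p. 0 \<le> G p" "\<And>p. p \<in> supp f \<Longrightarrow> G p = 1"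
    using smooth_Urysohn[OF s(1) open_U s(2)] by (metis subsetD)
  obtain C where C: "0 \<le> C" "\<And>p. \<bar>f p\<bar> \<le> C" using test_functions_bounded[OF f] by metis
  have CG: "(\<lambda>p. C * G p) \<in> test_functions U" by (rule test_functions_cmult[OF G(1)])
  have "0 \<le> f p + C * G p" for p
  proof (cases "p \<in> supp f")
    case True
    then show ?thesis using C(2)[of p] G(3)[of p] by simp
  next
    case False
    then show ?thesis using C(1) G(2)[of p] not_in_supp[of p f] by simp
  qed
  then have "T (\<lambda>p. f p + C * G p) = (\<integral>p. f p + C * G p \<partial>riesz_measure)"
    by (intro riesz_representation_nonneg test_functions_add f CG)
  moreover have "T (\<lambda>p. C * G p) = (\<integral>p. C * G p \<partial>riesz_measure)"
    using C(1) G(2) by (intro riesz_representation_nonneg CG) auto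
  ultimately show ?thesis
    using T_add[OF f CG] integrable_riesz_measure[OF f] integrable_riesz_measure[OF CG] by simp
qed

end

section \<open>Calculus of test functions\<close>

lemma has_real_derivative_cong01:
  assumes "(f has_real_derivative d) (at c within {0..1})" "c \<in> {0..1}"
    and "\<And>s. s \<in> {0..1} \<Longrightarrow> f s = g s"
  shows "(g has_real_derivative d) (at c within {0..1})"
  using assms(1) unfolding has_field_derivative_def
  by (rule has_derivative_transform[OF assms(2), rotated]) (simp add: assms(3))

section \<open>Slices of test functions at fixed \<xi>\<close>

lemma Ck_slice:
  fixes g :: "real \<times> real \<times> real \<Rightarrow> real"
  shows "Ck k g \<Longrightarrow> Ck k (\<lambda>p. g (fst p, snd p, \<xi>))"
proof (induction k arbitrary: g)
  case 0
  then show ?case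
    by (auto intro!: continuous_intros continuous_on_compose2[of UNIV g])
next
  case (Suc k)
  have d: "((\<lambda>p. g (fst p, snd p, \<xi>)) has_derivative
      (\<lambda>v. frechet_derivative g (at (fst p, snd p, \<xi>)) (fst v, snd v, 0))) (at p)" for p
    by (rule has_derivative_compose[OF _ Ck_Suc_has_derivative[OF Suc.prems]])
      (auto intro!: derivative_eq_intros)
  show ?case
  proof (rule Ck_SucI[OF d])
    fix b :: "real \<times> real" assume "b \<in> Basis"
    then have "(fst b, snd b, 0) \<in> (Basis :: (real \<times> real \<times> real) set)"
      by (auto simp: Basis_prod_def zero_prod_def)
    then have "Ck k (\<lambda>q. frechet_derivative g (at q) (fst b, snd b, 0))"
      using Suc.prems by simp
    from Suc.IH[OF this]
    show "Ck k (\<lambda>p. frechet_derivative g (at (fst p, snd p, \<xi>)) (fst b, snd b, 0))" .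
  qed
qed

lemma frechet_derivative_slice:
  assumes "\<phi> \<in> test_functions Omega_kin"
  shows "frechet_derivative (\<lambda>p. \<phi> (fst p, snd p, \<xi>)) (at p) v =
    frechet_derivative \<phi> (at (fst p, snd p, \<xi>)) (fst v, snd v, 0)"
proof -
  have "((\<lambda>p. \<phi> (fst p, snd p, \<xi>)) has_derivative
      (\<lambda>v. frechet_derivative \<phi> (at (fst p, snd p, \<xi>)) (fst v, snd v, 0))) (at p)"
    by (rule has_derivative_compose[OF _ test_functions_has_derivative[OF assms]])
      (auto intro!: derivative_eq_intros)
  then show ?thesis by (simp add: frechet_derivative_eqI)
qed

text \<open>For every \<xi> the slice is supported in the projection of \<open>supp \<phi>\<close>
  to (t,x), which is compact and contained in \<open>Omega\<close>.\<close>

lemma test_functions_slice: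
  assumes "\<phi> \<in> test_functions Omega_kin"
  shows "(\<lambda>p. \<phi> (fst p, snd p, \<xi>)) \<in> test_functions Omega"
proof (rule test_functionsI[where K = "(\<lambda>q. (fst q, fst (snd q))) ` supp \<phi>"])
  show "Ck k (\<lambda>p. \<phi> (fst p, snd p, \<xi>))" for k
    using assms by (intro Ck_slice) (auto simp: test_functions_iff)
  show "compact ((\<lambda>q. (fst q, fst (snd q))) ` supp \<phi>)"
    using assms by (auto simp: test_functions_iff intro!: compact_continuous_image continuous_intros)
  show "(\<lambda>q. (fst q, fst (snd q))) ` supp \<phi> \<subseteq> Omega"
    using assms by (auto simp: test_functions_iff Omega_kin_def Omega_def)
  show "\<phi> (fst p, snd p, \<xi>) = 0" if "p \<notin> (\<lambda>q. (fst q, fst (snd q))) ` supp \<phi>" for p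
  proof (rule not_in_supp[of _ \<phi>])
    show "(fst p, snd p, \<xi>) \<notin> supp \<phi>" using that by (force simp: image_iff)
  qed
qed

lemma test_functions_kin_zero:
  "\<phi> \<in> test_functions Omega_kin \<Longrightarrow> \<xi> \<notin> {0<..<1} \<Longrightarrow> \<phi> (t, x, \<xi>) = 0"
  by (rule not_in_supp) (auto simp: test_functions_iff Omega_kin_def)

text \<open>Equality of mixed partial derivatives: differentiate
  \<open>\<phi>(p + x e + s d) - \<phi>(p + x e) = \<integral>\<^sub>0\<^sup>s \<partial>\<^sub>d\<phi>(p + x e + r d) dr\<close> first in \<open>x\<close> under the integral and then
  in \<open>s\<close>.\<close>

lemma frechet_derivative_swap:
  fixes \<phi> :: "'a::euclidean_space \<Rightarrow> real"
  assumes \<phi>: "\<phi> \<in> test_functions U" and e: "e \<in> Basis" and d: "d \<in> Basis"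
  shows "frechet_derivative (\<lambda>p. frechet_derivative \<phi> (at p) d) (at p) e =
    frechet_derivative (\<lambda>p. frechet_derivative \<phi> (at p) e) (at p) d"
proof -
  define D where "D b f = (\<lambda>p. frechet_derivative f (at p) b)" for b and f :: "'a \<Rightarrow> real"
  have D_test: "D b f \<in> test_functions U" if "f \<in> test_functions U" "b \<in> Basis" for b f
    unfolding D_def by (rule test_functions_frechet_derivative[OF that])
  have line: "((\<lambda>x. f (q + x *\<^sub>R b)) has_real_derivative D b f (q + x *\<^sub>R b)) (at x within S)"
    if "f \<in> test_functions U" for f q b x S
  proof -
    have "((\<lambda>x. f (q + x *\<^sub>R b)) has_derivative
        (\<lambda>h. frechet_derivative f (at (q + x *\<^sub>R b)) (h *\<^sub>R b))) (at x)"
      by (rule has_derivative_compose[OF _ test_functions_has_derivative[OF that]])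
        (auto intro!: derivative_eq_intros)
    moreover have "linear (frechet_derivative f (at (q + x *\<^sub>R b)))"
      using test_functions_has_derivative[OF that] has_derivative_linear by blast
    ultimately have "((\<lambda>x. f (q + x *\<^sub>R b)) has_derivative (\<lambda>h. D b f (q + x *\<^sub>R b) * h)) (at x)"
      by (simp add: D_def linear_scale mult.commute)
    then show ?thesis
      unfolding has_field_derivative_def by (rule has_derivative_at_withinI)
  qed
  have cont: "continuous_on S (\<lambda>y. f (g y))" if "f \<in> test_functions U" "continuous_on S g"
    for f S and g :: "'b::topological_space \<Rightarrow> 'a"
    using continuous_on_compose2[OF test_functions_continuous[OF that(1)] that(2)] by simp
  have ftc: "((\<lambda>r. D d f (q + r *\<^sub>R d)) has_integral (f (q + s *\<^sub>R d) - f q)) {0..s}"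
    if "f \<in> test_functions U" "0 \<le> s" for f q s
    using fundamental_theorem_of_calculus[OF that(2), of "\<lambda>r. f (q + r *\<^sub>R d)"]
      line[OF that(1), of q d] by (simp add: has_real_derivative_iff_has_vector_derivative)
  have key: "D e \<phi> (p + s *\<^sub>R d) - D e \<phi> p = integral {0..s} (\<lambda>r. D e (D d \<phi>) (p + r *\<^sub>R d))"
    if s: "0 \<le> s" for s
  proof -
    have "((\<lambda>x. integral (cbox 0 s) (\<lambda>r. D d \<phi> ((p + r *\<^sub>R d) + x *\<^sub>R e))) has_real_derivative
        integral (cbox 0 s) (\<lambda>r. D e (D d \<phi>) ((p + r *\<^sub>R d) + 0 *\<^sub>R e))) (at 0 within UNIV)"
    proof (rule leibniz_rule_field_derivative)
      show "((\<lambda>x. D d \<phi> ((p + r *\<^sub>R d) + x *\<^sub>R e)) has_real_derivative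
          D e (D d \<phi>) ((p + r *\<^sub>R d) + x *\<^sub>R e)) (at x within UNIV)" for x r
        by (rule line[OF D_test[OF \<phi> d]])
      show "(\<lambda>r. D d \<phi> ((p + r *\<^sub>R d) + x *\<^sub>R e)) integrable_on cbox 0 s" for x
        by (intro integrable_continuous cont D_test \<phi> d continuous_intros)
      show "continuous_on (UNIV \<times> cbox 0 s) (\<lambda>(x, r). D e (D d \<phi>) ((p + r *\<^sub>R d) + x *\<^sub>R e))"
        unfolding case_prod_beta
        by (intro cont D_test \<phi> d e continuous_intros)
    qed auto
    moreover have "integral (cbox 0 s) (\<lambda>r. D d \<phi> ((p + r *\<^sub>R d) + x *\<^sub>R e)) =
        \<phi> ((p + s *\<^sub>R d) + x *\<^sub>R e) - \<phi> (p + x *\<^sub>R e)" for x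
      using integral_unique[OF ftc[OF \<phi> s, of "p + x *\<^sub>R e"]] by (simp add: add_ac)
    ultimately have "((\<lambda>x. \<phi> ((p + s *\<^sub>R d) + x *\<^sub>R e) - \<phi> (p + x *\<^sub>R e)) has_real_derivative
        integral {0..s} (\<lambda>r. D e (D d \<phi>) (p + r *\<^sub>R d))) (at 0)"
      by simp
    moreover have "((\<lambda>x. \<phi> ((p + s *\<^sub>R d) + x *\<^sub>R e) - \<phi> (p + x *\<^sub>R e)) has_real_derivative
        D e \<phi> (p + s *\<^sub>R d) - D e \<phi> p) (at 0)"
      using DERIV_diff[OF line[OF \<phi>, of "p + s *\<^sub>R d" e 0 UNIV] line[OF \<phi>, of p e 0 UNIV]] by simp
    ultimately show ?thesis by (rule DERIV_unique[symmetric])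
  qed
  \<comment> \<open>The integral identity holds only for \<open>s \<ge> 0\<close>, so the
    derivatives at 0 are one-sided; they are still unique, which suffices to identify the two
    values.\<close>
  have "((\<lambda>s. integral {0..s} (\<lambda>r. D e (D d \<phi>) (p + r *\<^sub>R d))) has_real_derivative
      D e (D d \<phi>) (p + 0 *\<^sub>R d)) (at 0 within {0..1})"
    by (rule integral_has_real_derivative) (intro cont D_test \<phi> d e continuous_intros, simp)
  moreover have "D e \<phi> (p + s *\<^sub>R d) - D e \<phi> p = integral {0..s} (\<lambda>r. D e (D d \<phi>) (p + r *\<^sub>R d))"
    if "s \<in> {0..1}" for s using key that by simp
  ultimately have "((\<lambda>s. D e \<phi> (p + s *\<^sub>R d) - D e \<phi> p) has_real_derivative
      D e (D d \<phi>) (p + 0 *\<^sub>R d)) (at 0 within {0..1})"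
    by (intro has_real_derivative_cong01[where g = "\<lambda>s. D e \<phi> (p + s *\<^sub>R d) - D e \<phi> p"]) auto
  moreover have "((\<lambda>s. D e \<phi> (p + s *\<^sub>R d) - D e \<phi> p) has_real_derivative
      D d (D e \<phi>) (p + 0 *\<^sub>R d)) (at 0 within {0..1})"
    using DERIV_diff[OF line[OF D_test[OF \<phi> e], of p d 0 "{0..1}"] DERIV_const[of "D e \<phi> p"]] by simp
  ultimately have "D e (D d \<phi>) (p + 0 *\<^sub>R d) = D d (D e \<phi>) (p + 0 *\<^sub>R d)"
    using vector_derivative_unique_within_closed_interval[of 0 1 0]
    by (auto simp: has_real_derivative_iff_has_vector_derivative)
  then show ?thesis by (simp add: D_def)
qed

section \<open>Derivatives on the unit interval\<close>

text \<open>Composition with this retraction extends a function that is continuous on [0,1] to one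
  that is continuous on the line, hence Borel measurable and bounded.\<close>

definition clamp01 :: "real \<Rightarrow> real" where
  "clamp01 s = max 0 (min 1 s)"

lemma clamp01_bounds: "0 \<le> clamp01 s" "clamp01 s \<le> 1"
  by (auto simp: clamp01_def)

lemma clamp01_id: "s \<in> {0..1} \<Longrightarrow> clamp01 s = s"
  by (auto simp: clamp01_def)

lemma continuous_on_clamp01: "continuous_on {0..1} f \<Longrightarrow> continuous_on UNIV (\<lambda>s. f (clamp01 s))"
  unfolding clamp01_def
  by (rule continuous_on_compose2[of "{0..1}" f]) (auto intro!: continuous_intros)

lemma D01_eqI:
  "(g has_real_derivative d) (at c within {0..1}) \<Longrightarrow> c \<in> {0..1} \<Longrightarrow> D01 g c = d"
  unfolding D01_def has_real_derivative_iff_has_vector_derivative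
  by (rule vector_derivative_within_closed_interval) auto

lemma D01_works:
  "g differentiable (at c within {0..1}) \<Longrightarrow> (g has_real_derivative D01 g c) (at c within {0..1})"
  unfolding D01_def has_real_derivative_iff_has_vector_derivative
  by (simp add: vector_derivative_works)

subsection \<open>Softplus entropies\<close>

text \<open>\<open>softplus n \<xi>\<close> is a smooth convex approximation of \<open>(s - \<xi>)\<^sup>+ - s = - min s \<xi>\<close>, with derivative
  \<open>- fermi n \<xi>\<close>.\<close>

definition fermi :: "nat \<Rightarrow> real \<Rightarrow> real \<Rightarrow> real" where
  "fermi n \<xi> s = inverse (1 + exp (real n * (s - \<xi>)))"

definition softplus :: "nat \<Rightarrow> real \<Rightarrow> real \<Rightarrow> real" where
  "softplus n \<xi> s = ln (1 + exp (real n * (s - \<xi>))) / real n - s"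

lemma fermi_bounds: "0 \<le> fermi n \<xi> s" "fermi n \<xi> s \<le> 1"
  by (auto simp: fermi_def field_simps add_pos_pos less_imp_le)

lemma fermi_has_derivative:
  "(fermi n \<xi> has_real_derivative - real n * (fermi n \<xi> s * (1 - fermi n \<xi> s))) (at s within S)"
proof -
  have "1 + exp (real n * (s - \<xi>)) \<noteq> 0" using exp_gt_zero[of "real n * (s - \<xi>)"] by linarith
  then show ?thesis
    unfolding fermi_def
    by (auto intro!: derivative_eq_intros simp: field_simps power2_eq_square)
qed

lemma softplus_has_derivative:
  assumes "0 < n"
  shows "(softplus n \<xi> has_real_derivative - fermi n \<xi> s) (at s within S)"
proof -
  define E where "E = exp (real n * (s - \<xi>))"
  have E: "0 < 1 + E" unfolding E_def by (intro add_pos_pos) auto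
  then have "(softplus n \<xi> has_real_derivative (real n * E / (1 + E)) / real n - 1) (at s within S)"
    unfolding softplus_def E_def by (auto intro!: derivative_eq_intros)
  moreover have "(real n * E / (1 + E)) / real n - 1 = - fermi n \<xi> s"
  proof -
    have "(real n * E / (1 + E)) / real n = E / (1 + E)" using assms by simp
    also have "\<dots> - 1 = - inverse (1 + E)" using E by (simp add: field_simps)
    finally show ?thesis unfolding fermi_def E_def[symmetric] .
  qed
  ultimately show ?thesis by simp
qed

text \<open>With \<open>y = n (s - \<xi>)\<close>, the quantity \<open>1 + exp y\<close> lies
  between \<open>exp (max y 0)\<close> and twice that; the factor 2 becomes the error
  \<open>ln 2\<close>, which is then divided by \<open>n\<close>.\<close>

lemma softplus_approx:
  assumes "0 < n"
  shows "\<bar>softplus n \<xi> s + min s \<xi>\<bar> \<le> ln 2 / real n"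
proof -
  define y where "y = real n * (s - \<xi>)"
  have "exp (max y 0) \<le> 1 + exp y" "1 + exp y \<le> 2 * exp (max y 0)"
    by (auto simp: max_def)
  then have "max y 0 \<le> ln (1 + exp y)" "ln (1 + exp y) \<le> ln (2 * exp (max y 0))"
    using exp_gt_zero[of y] by (auto simp: ln_ge_iff add_pos_pos intro!: ln_mono)
  then have 1: "max y 0 \<le> ln (1 + exp y)" "ln (1 + exp y) \<le> ln 2 + max y 0"
    by (auto simp: ln_mult)
  have 2: "max y 0 = real n * (s - min s \<xi>)"
    using assms by (auto simp: y_def max_def min_def mult_le_0_iff)
  have "\<bar>ln (1 + exp y) - max y 0\<bar> / real n \<le> ln 2 / real n"
    using 1 assms by (intro divide_right_mono) auto
  moreover have "softplus n \<xi> s + min s \<xi> = (ln (1 + exp y) - max y 0) / real n"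
    using assms by (simp add: softplus_def 2 field_simps flip: y_def)
  ultimately show ?thesis by simp
qed

text \<open>The derivative of \<open>fermi\<close> is itself a polynomial in \<open>fermi\<close>,
  so polynomials in \<open>fermi\<close> are closed under differentiation. This gives derivatives of
  every order without computing them.\<close>

lemma D01_iterates_poly_fermi:
  assumes "\<And>s. s \<in> {0..1} \<Longrightarrow> f s = poly P (fermi n \<xi> s)"
  shows "\<exists>R. \<forall>s\<in>{0..1}. (D01 ^^ k) f s = poly R (fermi n \<xi> s)"
proof (induction k)
  case 0
  then show ?case using assms by auto
next
  case (Suc k)
  then obtain R where R: "\<And>s. s \<in> {0..1} \<Longrightarrow> poly R (fermi n \<xi> s) = (D01 ^^ k) f s" by metis
  \<comment> \<open>The second factor is the polynomial - n X (1 - X) of the logistic equation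
    satisfied by \<open>fermi\<close>; the product is the chain rule.\<close>
  define Q where "Q = pderiv R * [:0, - real n, real n:]"
  have "(D01 ^^ Suc k) f s = poly Q (fermi n \<xi> s)" if s: "s \<in> {0..1}" for s
  proof -
    have "((\<lambda>s. poly R (fermi n \<xi> s)) has_real_derivative poly Q (fermi n \<xi> s)) (at s within {0..1})"
      using DERIV_chain2[OF poly_DERIV fermi_has_derivative, of R n \<xi> s "{0..1}"]
      by (simp add: Q_def algebra_simps)
    from D01_eqI[OF has_real_derivative_cong01[OF this s R] s] show ?thesis by simp
  qed
  then show ?case by blast
qed

lemma D01_softplus: "0 < n \<Longrightarrow> s \<in> {0..1} \<Longrightarrow> D01 (softplus n \<xi>) s = - fermi n \<xi> s"
  by (intro D01_eqI softplus_has_derivative)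

lemma smooth_on01_softplus:
  assumes "0 < n"
  shows "smooth_on01 (softplus n \<xi>)"
  unfolding smooth_on01_def
proof (intro allI ballI)
  fix k and c :: real assume c: "c \<in> {0..1}"
  show "(D01 ^^ k) (softplus n \<xi>) differentiable (at c within {0..1})"
  proof (cases k)
    case 0
    then show ?thesis
      using softplus_has_derivative[OF assms, of \<xi> c "{0..1}"]
      by (auto simp: has_field_derivative_def differentiable_def)
  next
    \<comment> \<open>\<open>softplus\<close> contains a logarithm, so the polynomial representation
      starts at its first derivative \<open>- fermi\<close>.\<close>
    case (Suc j)
    have "D01 (softplus n \<xi>) s = poly [:0, -1:] (fermi n \<xi> s)" if "s \<in> {0..1}" for s
      using D01_softplus[OF assms that] by simp
    from D01_iterates_poly_fermi[OF this, of j]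
    obtain R where R: "\<And>s. s \<in> {0..1} \<Longrightarrow> poly R (fermi n \<xi> s) = (D01 ^^ k) (softplus n \<xi>) s"
      unfolding Suc funpow_Suc_right comp_def by metis
    have "((\<lambda>s. poly R (fermi n \<xi> s)) has_real_derivative
        poly (pderiv R) (fermi n \<xi> c) * (- real n * (fermi n \<xi> c * (1 - fermi n \<xi> c))))
        (at c within {0..1})"
      by (rule DERIV_chain2[OF poly_DERIV fermi_has_derivative])
    from has_real_derivative_cong01[OF this c R] show ?thesis
      by (auto simp: has_field_derivative_def differentiable_def)
  qed
qed

lemma softplus_convex:
  assumes "0 < n" "s \<in> {0..1}"
  shows "0 \<le> (D01 ^^ 2) (softplus n \<xi>) s"
proof -
  have "((\<lambda>s. - fermi n \<xi> s) has_real_derivative real n * (fermi n \<xi> s * (1 - fermi n \<xi> s)))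
      (at s within {0..1})"
    using DERIV_minus[OF fermi_has_derivative[of n \<xi> s "{0..1}"]] by simp
  from has_real_derivative_cong01[OF this assms(2), of "D01 (softplus n \<xi>)"]
  have "D01 (D01 (softplus n \<xi>)) s = real n * (fermi n \<xi> s * (1 - fermi n \<xi> s))"
    using assms D01_softplus[OF assms(1)] by (intro D01_eqI) simp_all
  then show ?thesis using fermi_bounds[of n \<xi> s] by (simp add: numeral_2_eq_2)
qed

text \<open>\<open>Suc n\<close> keeps the parameter positive. The value 1/2 at the jump concerns a
  single point and disappears under integration.\<close>

lemma fermi_tendsto:
  "(\<lambda>n. fermi (Suc n) \<xi> s) \<longlonglongrightarrow> (if s < \<xi> then 1 else if s = \<xi> then 1 / 2 else 0)"
proof -
  have R: "filterlim (\<lambda>n. real (Suc n)) at_top sequentially"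
    by (rule filterlim_compose[OF filterlim_real_sequentially filterlim_Suc])
  consider "s < \<xi>" | "s = \<xi>" | "\<xi> < s" by linarith
  then show ?thesis
  proof cases
    case 1
    have "filterlim (\<lambda>n. (s - \<xi>) * real (Suc n)) at_bot sequentially"
      by (rule filterlim_tendsto_neg_mult_at_bot[OF tendsto_const _ R]) (use 1 in simp)
    then have "(\<lambda>n. inverse (1 + exp ((s - \<xi>) * real (Suc n)))) \<longlonglongrightarrow> inverse (1 + 0)"
      by (intro tendsto_intros filterlim_compose[OF exp_at_bot]) auto
    then show ?thesis using 1 by (simp add: fermi_def mult.commute)
  next
    case 2
    then show ?thesis by (simp add: fermi_def)
  next
    case 3
    have "filterlim (\<lambda>n. (s - \<xi>) * real (Suc n)) at_top sequentially"
      by (rule filterlim_tendsto_pos_mult_at_top[OF tendsto_const _ R]) (use 3 in simp)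
    then have "filterlim (\<lambda>n. exp ((s - \<xi>) * real (Suc n))) at_top sequentially"
      by (rule filterlim_compose[OF exp_at_top])
    then have "filterlim (\<lambda>n. 1 + exp ((s - \<xi>) * real (Suc n))) at_top sequentially"
      by (rule filterlim_tendsto_add_at_top[OF tendsto_const])
    then have "(\<lambda>n. inverse (1 + exp ((s - \<xi>) * real (Suc n)))) \<longlonglongrightarrow> 0"
      by (rule tendsto_inverse_0_at_top)
    then show ?thesis using 3 by (simp add: fermi_def mult.commute)
  qed
qed

lemma softplus_tendsto: "(\<lambda>n. softplus (Suc n) \<xi> s) \<longlonglongrightarrow> - min s \<xi>"
proof -
  have "(\<lambda>n. softplus (Suc n) \<xi> s + min s \<xi>) \<longlonglongrightarrow> 0"
  proof (rule Lim_null_comparison)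
    show "\<forall>\<^sub>F n in sequentially. norm (softplus (Suc n) \<xi> s + min s \<xi>) \<le> ln 2 / real (Suc n)"
      using softplus_approx[of "Suc _" \<xi> s] by simp
    show "(\<lambda>n. ln 2 / real (Suc n)) \<longlonglongrightarrow> 0" by (rule LIMSEQ_Suc[OF lim_const_over_n])
  qed
  from tendsto_diff[OF this tendsto_const[of "min s \<xi>"]] show ?thesis by simp
qed

lemma softplus_bound: "s \<in> {0..1} \<Longrightarrow> \<xi> \<in> {0..1} \<Longrightarrow> \<bar>softplus (Suc n) \<xi> s\<bar> \<le> 2"
proof -
  assume "s \<in> {0..1}" "\<xi> \<in> {0..1}"
  then have "\<bar>min s \<xi>\<bar> \<le> 1" by auto
  moreover have "ln 2 / real (Suc n) \<le> 1"
    using ln_2_less_1 by (simp add: field_simps)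
  ultimately show ?thesis using softplus_approx[of "Suc n" \<xi> s] by linarith
qed

lemma integral_fermi_tendsto:
  assumes a: "continuous_on {0..1} a" and s: "s \<in> {0..1}" and \<xi>: "\<xi> \<in> {0..1}"
  shows "(\<lambda>n. integral {0..s} (\<lambda>r. a r * - fermi (Suc n) \<xi> r)) \<longlonglongrightarrow> - integral {0..min s \<xi>} a"
proof -
  define g where "g r = a r * - (if r < \<xi> then 1 else if r = \<xi> then 1 / 2 else 0)" for r
  have a_on: "continuous_on {0..y} a" if "y \<le> 1" for y
    using a by (rule continuous_on_subset) (use that in auto)
  have "continuous_on S (fermi n \<xi>)" for n S
    by (rule DERIV_continuous_on[OF fermi_has_derivative])
  then have int: "(\<lambda>r. a r * - fermi n \<xi> r) integrable_on {0..s}" for n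
    using a_on[of s] s by (intro integrable_continuous_real continuous_intros) auto
  have conv: "(\<lambda>n. integral {0..s} (\<lambda>r. a r * - fermi (Suc n) \<xi> r)) \<longlonglongrightarrow> integral {0..s} g"
  proof (rule dominated_convergence(2)[where h = "\<lambda>r. \<bar>a r\<bar>", OF int])
    show "(\<lambda>r. \<bar>a r\<bar>) integrable_on {0..s}"
      using a_on[of s] s by (intro integrable_continuous_real continuous_intros) auto
    show "norm (a r * - fermi (Suc n) \<xi> r) \<le> \<bar>a r\<bar>" for n r
      using fermi_bounds[of "Suc n" \<xi> r] by (auto simp: abs_mult mult_left_le)
    show "(\<lambda>n. a r * - fermi (Suc n) \<xi> r) \<longlonglongrightarrow> g r" for r
      unfolding g_def by (intro tendsto_mult tendsto_const tendsto_minus fermi_tendsto)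
  qed
  have "((\<lambda>r. - a r) has_integral - integral {0..min s \<xi>} a) {0..min s \<xi>}"
    using a_on[of "min s \<xi>"] s
    by (intro has_integral_neg integrable_integral integrable_continuous_real) auto
  then have 1: "(g has_integral - integral {0..min s \<xi>} a) {0..min s \<xi>}"
    by (rule has_integral_spike_finite[where S = "{\<xi>}", rotated 2]) (auto simp: g_def)
  have "((\<lambda>r. 0) has_integral 0) {min s \<xi>..s}" by simp
  \<comment> \<open>The point \<xi> carries the value with factor 1/2. The point \<open>s\<close> is
    excepted for the case \<open>s < \<xi>\<close>, where the interval shrinks to \<open>s\<close>
    and \<open>g\<close> need not vanish there.\<close>
  then have 2: "(g has_integral 0) {min s \<xi>..s}"
    by (rule has_integral_spike_finite[where S = "{\<xi>, s}", rotated 2]) (auto simp: g_def)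
  have "(g has_integral - integral {0..min s \<xi>} a + 0) {0..s}"
    using s \<xi> by (intro has_integral_combine[OF _ _ 1 2]) auto
  then show ?thesis using conv by (simp add: integral_unique)
qed

subsection \<open>Integration by parts against a truncated primitive\<close>

text \<open>The truncated primitive is constant beyond \<open>s\<close>. The product rule on {0..s}
  leaves the boundary term \<open>B s * g s\<close>, which cancels against the integral of
  \<open>B s * g'\<close> over {s..1}; the outer boundary terms vanish with
  \<open>g\<close>.\<close>

lemma integral_truncated_by_parts:
  assumes b: "continuous_on {0..1} b" and s: "s \<in> {0..1}"
    and g: "\<And>\<xi>. (g has_real_derivative g' \<xi>) (at \<xi>)" and g': "continuous_on UNIV g'"
    and g0: "\<And>\<xi>. \<xi> \<notin> {0<..<1} \<Longrightarrow> g \<xi> = 0"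
  shows "((\<lambda>\<xi>. integral {0..min s \<xi>} b * g' \<xi>) has_integral - integral {0..s} (\<lambda>\<xi>. b \<xi> * g \<xi>)) {0..1}"
proof -
  define B where "B y = integral {0..y} b" for y
  have B_deriv: "(B has_real_derivative b y) (at y within {0..s})" if "y \<in> {0..s}" for y
    unfolding B_def
    by (rule has_field_derivative_subset[OF integral_has_real_derivative[OF b]]) (use that s in auto)
  have cg: "continuous_on S g" for S
    by (meson DERIV_isCont continuous_at_imp_continuous_on g)
  have bg: "((\<lambda>\<xi>. b \<xi> * g \<xi>) has_integral integral {0..s} (\<lambda>\<xi>. b \<xi> * g \<xi>)) {0..s}"
    using s cg by (intro integrable_integral integrable_continuous_real continuous_intros
        continuous_on_subset[OF b]) auto
  have "((\<lambda>\<xi>. b \<xi> * g \<xi> + B \<xi> * g' \<xi>) has_integral B s * g s - B 0 * g 0) {0..s}"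
  proof (rule fundamental_theorem_of_calculus)
    show "((\<lambda>\<xi>. B \<xi> * g \<xi>) has_vector_derivative b x * g x + B x * g' x) (at x within {0..s})"
      if "x \<in> {0..s}" for x
      using DERIV_mult[OF B_deriv[OF that] has_field_derivative_at_within[OF g]]
      by (simp add: has_real_derivative_iff_has_vector_derivative mult.commute add.commute)
  qed (use s in auto)
  from has_integral_diff[OF this bg]
  have "((\<lambda>\<xi>. B \<xi> * g' \<xi>) has_integral B s * g s - integral {0..s} (\<lambda>\<xi>. b \<xi> * g \<xi>)) {0..s}"
    using g0[of 0] by simp
  then have 1: "((\<lambda>\<xi>. B (min s \<xi>) * g' \<xi>) has_integral
      B s * g s - integral {0..s} (\<lambda>\<xi>. b \<xi> * g \<xi>)) {0..s}"
    by (rule has_integral_eq[rotated]) (auto simp: min_def)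
  have "(g' has_integral g 1 - g s) {s..1}"
  proof (rule fundamental_theorem_of_calculus)
    show "(g has_vector_derivative g' x) (at x within {s..1})" for x
      using has_field_derivative_at_within[OF g]
      by (simp add: has_real_derivative_iff_has_vector_derivative)
  qed (use s in auto)
  from has_integral_mult_right[OF this, of "B s"]
  have "((\<lambda>\<xi>. B s * g' \<xi>) has_integral - B s * g s) {s..1}"
    using g0[of 1] by simp
  then have 2: "((\<lambda>\<xi>. B (min s \<xi>) * g' \<xi>) has_integral - B s * g s) {s..1}"
    by (rule has_integral_eq[rotated]) (auto simp: min_def)
  from has_integral_combine[OF _ _ 1 2] s show ?thesis by (simp add: B_def)
qed

section \<open>Lebesgue integrals over the half space\<close>

lemma open_Omega: "open Omega"
  by (simp add: Omega_def open_Times)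

lemma open_Omega_kin: "open Omega_kin"
  by (simp add: Omega_kin_def open_Times)

section \<open>Fubini for the base (t,x) and the kinetic variable\<close>

abbreviation assoc3 :: "(real \<times> real) \<times> real \<Rightarrow> real \<times> real \<times> real" where
  "assoc3 q \<equiv> (fst (fst q), snd (fst q), snd q)"

lemma assoc3_measurable: "assoc3 \<in> borel_measurable (lborel \<Otimes>\<^sub>M lborel)"
proof -
  have "assoc3 \<in> borel_measurable borel"
    by (intro borel_measurable_continuous_onI continuous_intros)
  then show ?thesis by (simp add: lborel_prod)
qed

text \<open>Triples are nested to the right, while Fubini with (t,x) as one variable needs the left
  nesting. Regrouping preserves volumes of boxes, and these determine Lebesgue measure.\<close>

lemma lborel_assoc3: "distr (lborel \<Otimes>\<^sub>M lborel) borel assoc3 = lborel"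
proof (rule lborel_eqI[symmetric])
  fix l u :: "real \<times> real \<times> real"
  assume lu: "\<And>b. b \<in> Basis \<Longrightarrow> l \<bullet> b \<le> u \<bullet> b"
  obtain l1 l2 l3 where l: "l = (l1, l2, l3)" by (cases l) auto
  obtain u1 u2 u3 where u: "u = (u1, u2, u3)" by (cases u) auto
  have le: "l1 \<le> u1" "l2 \<le> u2" "l3 \<le> u3"
    using lu[of "(1, 0, 0)"] lu[of "(0, 1, 0)"] lu[of "(0, 0, 1)"]
    by (auto simp: l u Basis_prod_def zero_prod_def)
  have "assoc3 -` box l u \<inter> space (lborel \<Otimes>\<^sub>M lborel) = box (l1, l2) (u1, u2) \<times> box l3 u3"
    by (auto simp: l u box_def Basis_prod_def space_pair_measure zero_prod_def)
  then have "emeasure (distr (lborel \<Otimes>\<^sub>M lborel) borel assoc3) (box l u) =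
      emeasure lborel (box (l1, l2) (u1, u2)) * emeasure lborel (box l3 u3)"
    by (simp add: emeasure_distr[OF assoc3_measurable] lborel.emeasure_pair_measure_Times)
  also have "emeasure lborel (box (l1, l2) (u1, u2)) = ennreal ((u1 - l1) * (u2 - l2))"
    using le by (subst emeasure_lborel_box) (auto simp: Basis_prod_def zero_prod_def)
  also have "emeasure lborel (box l3 u3) = ennreal (u3 - l3)"
    using le by (subst emeasure_lborel_box) auto
  also have "ennreal ((u1 - l1) * (u2 - l2)) * ennreal (u3 - l3) =
      ennreal (\<Prod>b\<in>Basis. (u - l) \<bullet> b)"
    using le by (simp add: l u Basis_prod_def zero_prod_def ennreal_mult[symmetric] mult.assoc)
  finally show "emeasure (distr (lborel \<Otimes>\<^sub>M lborel) borel assoc3) (box l u) =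
      ennreal (\<Prod>b\<in>Basis. (u - l) \<bullet> b)" .
qed simp

lemma
  fixes f :: "real \<times> real \<times> real \<Rightarrow> real"
  assumes f: "integrable lborel f"
  shows integral_assoc3_fst:
      "integral\<^sup>L lborel f = (\<integral>p. (\<integral>\<xi>. f (fst p, snd p, \<xi>) \<partial>lborel) \<partial>lborel)"
    and integral_assoc3_snd:
      "integral\<^sup>L lborel f = (\<integral>\<xi>. (\<integral>p. f (fst p, snd p, \<xi>) \<partial>lborel) \<partial>lborel)"
proof -
  note m = assoc3_measurable
  have fm: "f \<in> borel_measurable borel" using f by auto
  have i: "integrable (lborel \<Otimes>\<^sub>M lborel) (\<lambda>(p, \<xi>). f (fst p, snd p, \<xi>))"
    using f integrable_distr_eq[OF m fm] by (simp add: lborel_assoc3 case_prod_beta')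
  have e: "integral\<^sup>L lborel f = (\<integral>(p, \<xi>). f (fst p, snd p, \<xi>) \<partial>(lborel \<Otimes>\<^sub>M lborel))"
    using integral_distr[OF m fm] by (simp add: lborel_assoc3 case_prod_beta')
  show "integral\<^sup>L lborel f = (\<integral>p. (\<integral>\<xi>. f (fst p, snd p, \<xi>) \<partial>lborel) \<partial>lborel)"
    using lborel_pair.integral_fst[OF i] e by simp
  show "integral\<^sup>L lborel f = (\<integral>\<xi>. (\<integral>p. f (fst p, snd p, \<xi>) \<partial>lborel) \<partial>lborel)"
    using lborel_pair.integral_snd[OF i] e by simp
qed

lemma AE_assoc3:
  assumes "AE p in (lborel :: (real \<times> real) measure). P p"
  shows "AE q in (lborel :: (real \<times> real \<times> real) measure). P (fst q, fst (snd q))"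
proof -
  obtain N where N: "N \<in> null_sets lborel" "{p. \<not> P p} \<subseteq> N"
    using assms by (auto simp: eventually_ae_filter)
  define N3 where "N3 = (\<lambda>q :: real \<times> real \<times> real. (fst q, fst (snd q))) -` N"
  have Nb: "N \<in> sets borel" using N(1) by auto
  have "(\<lambda>q :: real \<times> real \<times> real. (fst q, fst (snd q))) \<in> borel_measurable borel"
    by (intro borel_measurable_continuous_onI continuous_intros)
  from measurable_sets[OF this Nb] have N3b: "N3 \<in> sets borel" by (simp add: N3_def)
  have "emeasure lborel N3 = emeasure (lborel \<Otimes>\<^sub>M lborel) (N \<times> (UNIV :: real set))"
    using N3b by (subst lborel_assoc3[symmetric], subst emeasure_distr[OF assoc3_measurable])
      (auto simp: N3_def space_pair_measure intro!: arg_cong[where f = "emeasure _"])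
  also have "\<dots> = emeasure lborel N * emeasure lborel (UNIV :: real set)"
    using Nb by (intro lborel.emeasure_pair_measure_Times) auto
  \<comment> \<open>The cylinder over \<open>N\<close> has infinite height; the product 0 times
    infinity is 0 in \<open>ennreal\<close>.\<close>
  also have "\<dots> = 0" using N(1) by auto
  finally have "N3 \<in> null_sets lborel" using N3b by auto
  then show ?thesis
    by (rule AE_I') (use N(2) in \<open>auto simp: N3_def\<close>)
qed

lemma integrable_mult_test_function:
  assumes F: "F \<in> borel_measurable borel" and \<phi>: "\<phi> \<in> test_functions U"
    and B: "AE p in lborel. p \<in> supp \<phi> \<longrightarrow> \<bar>F p\<bar> \<le> B"
  shows "integrable lborel (\<lambda>p. F p * \<phi> p)"
proof -
  obtain C where C: "0 \<le> C" "\<And>p. \<bar>\<phi> p\<bar> \<le> C" using test_functions_bounded[OF \<phi>] by metis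
  have K: "compact (supp \<phi>)" using \<phi> by (simp add: test_functions_iff)
  show ?thesis
  proof (rule integrableI_bounded_set[where A = "supp \<phi>" and B = "B * C"])
    show "supp \<phi> \<in> sets lborel" by (simp add: borel_closed)
    have "\<phi> \<in> borel_measurable borel"
      by (rule borel_measurable_continuous_onI[OF test_functions_continuous[OF \<phi>]])
    then show "(\<lambda>p. F p * \<phi> p) \<in> borel_measurable lborel" using F by simp
    show "emeasure lborel (supp \<phi>) < \<infinity>" by (rule emeasure_compact_finite[OF K])
    show "AE p in lborel. p \<in> supp \<phi> \<longrightarrow> norm (F p * \<phi> p) \<le> B * C"
      using B by eventually_elim (use C in \<open>auto simp: abs_mult intro!: mult_mono\<close>)
    show "AE p in lborel. p \<notin> supp \<phi> \<longrightarrow> F p * \<phi> p = 0" by (simp add: not_in_supp)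
  qed
qed

section \<open>From Lebesgue measurable densities to Borel representatives\<close>

lemma AE_lebesgue_on_iff:
  assumes "A \<in> sets lebesgue"
  shows "(AE p in lebesgue_on A. P p) \<longleftrightarrow> (AE p in lborel. p \<in> A \<longrightarrow> P p)"
  using assms by (subst AE_restrict_space_iff) (auto simp: AE_completion_iff)

text \<open>The test function vanishes off \<open>U\<close>, so the integrand extends by 0, and null
  sets do not matter; afterwards only integrals over \<open>lborel\<close> remain, where Fubini is
  available.\<close>

lemma dist_fun_borel:
  assumes U: "open U" and \<phi>: "\<phi> \<in> test_functions U"
    and F': "F' \<in> borel_measurable borel" and eq: "AE p in lborel. p \<in> U \<longrightarrow> F p = F' p"
  shows "dist_fun U F \<phi> = (\<integral>p. F' p * \<phi> p \<partial>lborel)"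
proof -
  have \<phi>0: "\<phi> p = 0" if "p \<notin> U" for p
    using \<phi> that by (intro not_in_supp) (auto simp: test_functions_iff)
  have "\<phi> \<in> borel_measurable borel"
    by (rule borel_measurable_continuous_onI[OF test_functions_continuous[OF \<phi>]])
  then have m: "(\<lambda>p. F' p * \<phi> p) \<in> borel_measurable lborel" using F' by simp
  then have mL: "(\<lambda>p. F' p * \<phi> p) \<in> borel_measurable lebesgue" by (rule measurable_completion)
  have ae: "AE p in lebesgue. F' p * \<phi> p = indicator U p *\<^sub>R (F p * \<phi> p)"
    using AE_completion[OF eq] by eventually_elim (auto simp: \<phi>0 indicator_def)
  have "dist_fun U F \<phi> = (\<integral>p. indicator U p *\<^sub>R (F p * \<phi> p) \<partial>lebesgue)"
    unfolding dist_fun_def using U by (intro integral_restrict_space) auto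
  also have "\<dots> = (\<integral>p. F' p * \<phi> p \<partial>lebesgue)"
    by (rule integral_cong_AE[OF borel_measurable_AE[OF mL ae] mL]) (use ae in auto)
  also have "\<dots> = (\<integral>p. F' p * \<phi> p \<partial>lborel)" by (rule integral_completion[OF m])
  finally show ?thesis .
qed

lemma borel_representative:
  fixes f :: "'a::euclidean_space \<Rightarrow> real"
  assumes "f \<in> borel_measurable (lebesgue_on U)" "open U"
  obtains g where "g \<in> borel_measurable borel" "AE p in lborel. p \<in> U \<longrightarrow> f p = g p"
proof -
  have "(\<lambda>p. if p \<in> U then f p else 0) \<in> borel_measurable lebesgue"
    using assms by (intro borel_measurable_if_I) auto
  from completion_ex_borel_measurable_real[OF this]
  obtain g where "g \<in> borel_measurable lborel" "AE p in lborel. (if p \<in> U then f p else 0) = g p"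
    by auto
  then show thesis by (intro that[of g]) (auto elim: eventually_mono)
qed

text \<open>The integration by parts above, on the whole line and for the Lebesgue integral.
  Integrability is recorded separately because several such integrals are later added under one
  sign.\<close>

lemma
  assumes b: "continuous_on {0..1} b" and s: "s \<in> {0..1}"
    and g: "\<And>\<xi>. (g has_real_derivative g' \<xi>) (at \<xi>)" and g': "continuous_on UNIV g'"
    and g0: "\<And>\<xi>. \<xi> \<notin> {0<..<1} \<Longrightarrow> g \<xi> = 0" "\<And>\<xi>. \<xi> \<notin> {0<..<1} \<Longrightarrow> g' \<xi> = 0"
  shows integrable_truncated_primitive:
      "integrable lborel (\<lambda>\<xi>. integral {0..clamp01 (min s \<xi>)} b * g' \<xi>)"
    and integrable_chi:
      "integrable lborel (\<lambda>\<xi>. b (clamp01 \<xi>) * chi s \<xi> * g \<xi>)"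
    and lborel_integral_by_parts:
      "(\<integral>\<xi>. integral {0..clamp01 (min s \<xi>)} b * g' \<xi> \<partial>lborel) =
        - (\<integral>\<xi>. b (clamp01 \<xi>) * chi s \<xi> * g \<xi> \<partial>lborel)"
proof -
  have cg: "continuous_on S g" for S
    by (meson DERIV_isCont continuous_at_imp_continuous_on g)
  define B where "B y = integral {0..y} b" for y
  have cB: "continuous_on {0..1} B"
    unfolding B_def by (intro indefinite_integral_continuous_1 integrable_continuous_real b)
  have c1: "continuous_on UNIV (\<lambda>\<xi>. B (clamp01 (min s \<xi>)) * g' \<xi>)"
    by (intro continuous_on_mult g' continuous_on_compose2[OF continuous_on_clamp01[OF cB]]
        continuous_intros) auto
  have c2: "continuous_on UNIV (\<lambda>\<xi>. b (clamp01 \<xi>) * g \<xi>)"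
    by (intro continuous_on_mult cg continuous_on_clamp01 b)
  \<comment> \<open>The bounded factor \<open>k\<close> is 1 for the truncated primitive and
    \<open>chi s\<close> for the density.\<close>
  have int: "integrable lborel (\<lambda>\<xi>. k \<xi> * f \<xi>)"
    if f: "continuous_on UNIV f" and f0: "\<And>\<xi>. \<xi> \<notin> {0<..<1} \<Longrightarrow> f \<xi> = 0"
      and k: "k \<in> borel_measurable borel" "\<And>\<xi>. \<bar>k \<xi>\<bar> \<le> 1" for f k :: "real \<Rightarrow> real"
  proof -
    have "compact (f ` {0..1})"
      using f by (intro compact_continuous_image) (auto intro: continuous_on_subset)
    then obtain M where M: "\<And>\<xi>. \<xi> \<in> {0..1} \<Longrightarrow> norm (f \<xi>) \<le> M"
      using compact_imp_bounded bounded_iff by (metis imageI)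
    have M': "norm (k \<xi> * f \<xi>) \<le> M" if "\<xi> \<in> {0..1}" for \<xi>
      using mult_mono[OF k(2)[of \<xi>] M[OF that]] by (simp add: abs_mult)
    show ?thesis
      by (rule integrableI_bounded_set[where A = "{0..1}" and B = M])
        (use k borel_measurable_continuous_onI[OF f] M' f0 in auto)
  qed
  have chi_m: "chi s \<in> borel_measurable borel" unfolding chi_def by measurable
  show i1: "integrable lborel (\<lambda>\<xi>. integral {0..clamp01 (min s \<xi>)} b * g' \<xi>)"
    using int[OF c1, of "\<lambda>_. 1"] g0(2) by (simp add: B_def)
  show i2: "integrable lborel (\<lambda>\<xi>. b (clamp01 \<xi>) * chi s \<xi> * g \<xi>)"
    using int[OF c2 _ chi_m] g0(1) by (simp add: chi_def mult_ac)
  have "((\<lambda>\<xi>. integral {0..clamp01 (min s \<xi>)} b * g' \<xi>) has_integral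
      - integral {0..s} (\<lambda>\<xi>. b \<xi> * g \<xi>)) {0..1}"
    using s by (intro has_integral_eq[OF _ integral_truncated_by_parts[OF b s g g' g0(1)]])
      (auto simp: clamp01_id)
  then have "((\<lambda>\<xi>. integral {0..clamp01 (min s \<xi>)} b * g' \<xi>) has_integral
      - integral {0..s} (\<lambda>\<xi>. b \<xi> * g \<xi>)) UNIV"
    by (rule has_integral_on_superset) (auto simp: g0)
  from has_integral_unique[OF has_integral_integral_lborel[OF i1] this]
  have 1: "(\<integral>\<xi>. integral {0..clamp01 (min s \<xi>)} b * g' \<xi> \<partial>lborel) =
      - integral {0..s} (\<lambda>\<xi>. b \<xi> * g \<xi>)" .
  have "((\<lambda>\<xi>. b \<xi> * g \<xi>) has_integral integral {0..s} (\<lambda>\<xi>. b \<xi> * g \<xi>)) {0..s}"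
    using s cg by (intro integrable_integral integrable_continuous_real continuous_intros
        continuous_on_subset[OF b]) auto
  \<comment> \<open>\<open>chi s\<close> is 1 strictly between 0 and \<open>s\<close> but 0 at both
    end points, hence the two exceptional points.\<close>
  then have "((\<lambda>\<xi>. b (clamp01 \<xi>) * chi s \<xi> * g \<xi>) has_integral
      integral {0..s} (\<lambda>\<xi>. b \<xi> * g \<xi>)) {0..s}"
    by (rule has_integral_spike_finite[where S = "{0, s}", rotated 2])
      (use s in \<open>auto simp: chi_def clamp01_id\<close>)
  then have "((\<lambda>\<xi>. b (clamp01 \<xi>) * chi s \<xi> * g \<xi>) has_integral
      integral {0..s} (\<lambda>\<xi>. b \<xi> * g \<xi>)) UNIV"
    by (rule has_integral_on_superset) (auto simp: chi_def)
  from has_integral_unique[OF has_integral_integral_lborel[OF i2] this] 1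
  show "(\<integral>\<xi>. integral {0..clamp01 (min s \<xi>)} b * g' \<xi> \<partial>lborel) =
        - (\<integral>\<xi>. b (clamp01 \<xi>) * chi s \<xi> * g \<xi> \<partial>lborel)" by simp
qed

lemma test_functions_kin_line_derivative:
  assumes "\<phi> \<in> test_functions Omega_kin"
  shows "((\<lambda>\<xi>. \<phi> (t, x, \<xi>)) has_real_derivative frechet_derivative \<phi> (at (t, x, \<xi>)) (0, 0, 1)) (at \<xi>)"
proof -
  let ?D = "frechet_derivative \<phi> (at (t, x, \<xi>))"
  have d: "((\<lambda>\<xi>. \<phi> (t, x, \<xi>)) has_derivative (\<lambda>h. ?D (0, 0, h))) (at \<xi>)"
    by (rule has_derivative_compose[OF _ test_functions_has_derivative[OF assms]])
      (auto intro!: derivative_eq_intros)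
  have "linear ?D"
    using test_functions_has_derivative[OF assms] has_derivative_linear by blast
  then have "?D (0, 0, h) = ?D (0, 0, 1) * h" for h
    using linear_scale[of ?D h "(0, 0, 1)"] by simp
  then have eq: "(\<lambda>h. ?D (0, 0, h)) = (\<lambda>h. ?D (0, 0, 1) * h)" by (rule ext)
  show ?thesis using d unfolding has_field_derivative_def eq .
qed

lemma borel_compose01:
  assumes "continuous_on {0..1} f" "g \<in> borel_measurable M"
  shows "(\<lambda>x. f (clamp01 (g x))) \<in> borel_measurable M"
  using measurable_compose[OF assms(2) borel_measurable_continuous_onI[OF continuous_on_clamp01[OF assms(1)]]] .

lemma bounded01:
  fixes f :: "real \<Rightarrow> real"
  assumes "continuous_on {0..1} f"
  obtains B where "0 \<le> B" "\<And>s. s \<in> {0..1} \<Longrightarrow> \<bar>f s\<bar> \<le> B"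
proof -
  have "compact (f ` {0..1})" by (intro compact_continuous_image assms) simp
  then obtain B where B: "\<And>s. s \<in> {0..1} \<Longrightarrow> norm (f s) \<le> B"
    using compact_imp_bounded bounded_iff by (metis imageI)
  then show thesis by (intro that[of B]) (auto intro: order_trans[OF abs_ge_zero B[of 0, unfolded real_norm_def]])
qed

lemma base_measurable:
  "f \<in> borel_measurable borel \<Longrightarrow>
    (\<lambda>q :: real \<times> real \<times> real. f (fst q, fst (snd q)) :: real) \<in> borel_measurable borel"
  by (rule measurable_compose[where N = borel])
    (intro borel_measurable_continuous_onI continuous_intros)

lemma kin_basis: "(1, 0, 0) \<in> (Basis :: (real \<times> real \<times> real) set)"
    "(0, 1, 0) \<in> (Basis :: (real \<times> real \<times> real) set)"
    "(0, 0, 1) \<in> (Basis :: (real \<times> real \<times> real) set)"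
  by (auto simp: Basis_prod_def zero_prod_def)

lemma integrable_bounded_mult:
  fixes f g :: "real \<Rightarrow> real" and r k :: "'a::euclidean_space \<Rightarrow> real"
  assumes f: "continuous_on {0..1} f" and g: "continuous_on {0..1} g"
    and r: "r \<in> borel_measurable borel" "\<And>q. r q \<in> {0..1}"
    and k: "k \<in> borel_measurable borel" "\<And>q. k q \<in> {0..1}"
    and \<phi>: "\<phi> \<in> test_functions U"
  shows "integrable lborel (\<lambda>q. (f (r q) * g (k q)) * \<phi> q)"
proof -
  obtain Bf where Bf: "0 \<le> Bf" "\<And>s. s \<in> {0..1} \<Longrightarrow> \<bar>f s\<bar> \<le> Bf" using bounded01[OF f] by metis
  obtain Bg where Bg: "0 \<le> Bg" "\<And>s. s \<in> {0..1} \<Longrightarrow> \<bar>g s\<bar> \<le> Bg" using bounded01[OF g] by metis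
  show ?thesis
  proof (rule integrable_mult_test_function[OF _ \<phi>, where B = "Bf * Bg"])
    show "(\<lambda>q. f (r q) * g (k q)) \<in> borel_measurable borel"
      using borel_measurable_times[OF borel_compose01[OF f r(1)] borel_compose01[OF g k(1)]]
      by (simp only: clamp01_id[OF r(2)] clamp01_id[OF k(2)])
    show "AE q in lborel. q \<in> supp \<phi> \<longrightarrow> \<bar>f (r q) * g (k q)\<bar> \<le> Bf * Bg"
      unfolding abs_mult using Bf Bg r(2) k(2) by (intro AE_I2 impI mult_mono) auto
  qed
qed

section \<open>The kinetic distribution\<close>

text \<open>What survives of an entropy solution after passing to everywhere defined Borel
  representatives and testing with softplus entropies alone. The inequality reads
  \<open>0 \<le>\<close> because moving the derivatives onto \<phi> changes the sign.\<close>

locale kinetic_setting =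
  fixes h a :: "real \<Rightarrow> real" and v C :: "real \<times> real \<Rightarrow> real"
  assumes h_cont: "continuous_on {0..1} h" and a_cont: "continuous_on {0..1} a"
    and C_borel: "C \<in> borel_measurable borel" and C_range: "\<And>p. C p \<in> {0..1}"
    and v_borel: "v \<in> borel_measurable borel"
    and v_bounded: "\<And>K. compact K \<Longrightarrow> K \<subseteq> Omega \<Longrightarrow> \<exists>B. AE p in lborel. p \<in> K \<longrightarrow> \<bar>v p\<bar> \<le> B"
    and softplus_entropy: "\<And>n \<xi> \<phi>. 0 < n \<Longrightarrow> \<xi> \<in> {0<..<1} \<Longrightarrow> \<phi> \<in> test_functions Omega \<Longrightarrow>
      (\<And>p. 0 \<le> \<phi> p) \<Longrightarrow>
      0 \<le> (\<integral>p. v p * softplus n \<xi> (C p) * frechet_derivative \<phi> (at p) (0, 1) \<partial>lborel) +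
        (\<integral>p. (h (C p) * softplus n \<xi> (C p) + integral {0..C p} (\<lambda>r. a r * - fermi n \<xi> r)) *
          frechet_derivative \<phi> (at p) (1, 0) \<partial>lborel)"
begin

lemma borel_compose_C:
  assumes "continuous_on {0..1} f"
  shows "(\<lambda>p. f (C p)) \<in> borel_measurable borel"
  using borel_compose01[OF assms C_borel] by (simp only: clamp01_id[OF C_range])

definition A :: "real \<Rightarrow> real" where
  "A y = integral {0..y} a"

lemma A_cont: "continuous_on {0..1} A"
  unfolding A_def by (intro indefinite_integral_continuous_1 integrable_continuous_real a_cont)

text \<open>Dominated convergence in the softplus inequalities. Entropy and flux both converge to
  negatives, namely of \<open>min (C p) \<xi>\<close> and of the flux displayed here, which reverses
  the inequality.\<close>

lemma limit_entropy:
  assumes \<xi>: "\<xi> \<in> {0<..<1}" and \<phi>: "\<phi> \<in> test_functions Omega" "\<And>p. 0 \<le> \<phi> p"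
  shows "(\<integral>p. v p * min (C p) \<xi> * frechet_derivative \<phi> (at p) (0, 1) +
      (A (min (C p) \<xi>) + h (C p) * min (C p) \<xi>) * frechet_derivative \<phi> (at p) (1, 0) \<partial>lborel) \<le> 0"
proof -
  define \<phi>x where "\<phi>x p = frechet_derivative \<phi> (at p) (0, 1)" for p
  define \<phi>t where "\<phi>t p = frechet_derivative \<phi> (at p) (1, 0)" for p
  have \<phi>x: "\<phi>x \<in> test_functions Omega" and \<phi>t: "\<phi>t \<in> test_functions Omega"
    unfolding \<phi>x_def \<phi>t_def
    by (intro test_functions_frechet_derivative \<phi>; simp add: Basis_prod_def zero_prod_def)+
  have [measurable]: "\<phi>x \<in> borel_measurable borel" "\<phi>t \<in> borel_measurable borel"
    using \<phi>x \<phi>t by (auto intro: borel_measurable_continuous_onI test_functions_continuous)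
  note [measurable] = v_borel C_borel
  define Q where "Q n s = h s * softplus n \<xi> s + integral {0..s} (\<lambda>r. a r * - fermi n \<xi> r)" for n s
  have sp_cont: "continuous_on S (softplus n \<xi>)" if "0 < n" for n S
    by (rule DERIV_continuous_on[OF softplus_has_derivative[OF that]])
  have fermi_cont: "continuous_on S (fermi n \<xi>)" for n S
    by (rule DERIV_continuous_on[OF fermi_has_derivative])
  have Q_cont: "continuous_on {0..1} (Q n)" if "0 < n" for n
    unfolding Q_def
    by (intro continuous_intros h_cont sp_cont[OF that] indefinite_integral_continuous_1
        integrable_continuous_real a_cont fermi_cont)
  have [measurable]: "(\<lambda>p. softplus (Suc n) \<xi> (C p)) \<in> borel_measurable borel"
      "(\<lambda>p. Q (Suc n) (C p)) \<in> borel_measurable borel" for n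
    by (intro borel_compose_C sp_cont Q_cont; simp)+
  have [measurable]: "(\<lambda>p. h (C p)) \<in> borel_measurable borel" by (rule borel_compose_C[OF h_cont])
  have [measurable]: "(\<lambda>p. A (min (C p) \<xi>)) \<in> borel_measurable borel"
  proof -
    have "(\<lambda>p. A (clamp01 (min (C p) \<xi>))) \<in> borel_measurable borel"
      by (rule borel_compose01[OF A_cont]) measurable
    moreover have "clamp01 (min (C p) \<xi>) = min (C p) \<xi>" for p
      using C_range[of p] \<xi> by (intro clamp01_id) auto
    ultimately show ?thesis by simp
  qed
  obtain Bh where Bh: "0 \<le> Bh" "\<And>s. s \<in> {0..1} \<Longrightarrow> \<bar>h s\<bar> \<le> Bh" using bounded01[OF h_cont] by metis
  obtain Ba where Ba: "0 \<le> Ba" "\<And>s. s \<in> {0..1} \<Longrightarrow> \<bar>a s\<bar> \<le> Ba" using bounded01[OF a_cont] by metis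
  have int_bound: "\<bar>integral {0..s} (\<lambda>r. a r * - fermi n \<xi> r)\<bar> \<le> Ba" if s: "s \<in> {0..1}" for n s
  proof -
    have "norm (integral {0..s} (\<lambda>r. a r * - fermi n \<xi> r)) \<le> Ba * (s - 0)"
    proof (rule integral_bound)
      show "continuous_on {0..s} (\<lambda>r. a r * - fermi n \<xi> r)"
        using s by (intro continuous_intros continuous_on_subset[OF a_cont] fermi_cont) auto
      show "norm (a r * - fermi n \<xi> r) \<le> Ba" if "r \<in> {0..s}" for r
        using mult_mono[OF Ba(2)[of r] fermi_bounds(2)[of n \<xi> r]] fermi_bounds(1)[of n \<xi> r] that s Ba(1)
        by (auto simp: abs_mult)
    qed (use s in auto)
    also have "\<dots> \<le> Ba" using s Ba(1) by (simp add: mult_left_le)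
    finally show ?thesis by simp
  qed
  have Q_bound: "\<bar>Q (Suc n) s\<bar> \<le> Bh * 2 + Ba" if s: "s \<in> {0..1}" for n s
  proof -
    have "\<bar>h s * softplus (Suc n) \<xi> s\<bar> \<le> Bh * 2"
      unfolding abs_mult using \<xi> s Bh by (intro mult_mono softplus_bound) auto
    then show ?thesis using int_bound[OF s, of "Suc n"] unfolding Q_def by linarith
  qed
  obtain Bx where Bx: "AE p in lborel. p \<in> supp \<phi>x \<longrightarrow> \<bar>v p\<bar> \<le> Bx"
    using v_bounded[of "supp \<phi>x"] \<phi>x by (auto simp: test_functions_iff)
  have "integrable lborel (\<lambda>p. v p * \<phi>x p)"
    by (rule integrable_mult_test_function[OF v_borel \<phi>x Bx])
  from integrable_mult_right[OF integrable_abs[OF this], of 2]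
  have w1: "integrable lborel (\<lambda>p. 2 * \<bar>v p * \<phi>x p\<bar>)" .
  have "integrable lborel (\<lambda>p. 1 * \<phi>t p)"
    by (rule integrable_mult_test_function[OF _ \<phi>t, where B = 1]) auto
  from integrable_mult_right[OF integrable_abs[OF this], of "Bh * 2 + Ba"]
  have w2: "integrable lborel (\<lambda>p. (Bh * 2 + Ba) * \<bar>\<phi>t p\<bar>)" by simp
  \<comment> \<open>The majorant: 2 bounds the softplus entropies on the unit interval and
    \<open>Bh * 2 + Ba\<close> bounds the fluxes \<open>Q\<close>, both uniformly in
    \<open>n\<close>.\<close>
  define w where "w p = 2 * \<bar>v p * \<phi>x p\<bar> + (Bh * 2 + Ba) * \<bar>\<phi>t p\<bar>" for p
  have w: "integrable lborel w" unfolding w_def using w1 w2 by (rule Bochner_Integration.integrable_add)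
  have b1: "\<bar>v p * softplus (Suc n) \<xi> (C p) * \<phi>x p\<bar> \<le> 2 * \<bar>v p * \<phi>x p\<bar>" for n p
  proof -
    have "\<bar>softplus (Suc n) \<xi> (C p)\<bar> * \<bar>v p * \<phi>x p\<bar> \<le> 2 * \<bar>v p * \<phi>x p\<bar>"
      using C_range[of p] \<xi> by (intro mult_right_mono softplus_bound) auto
    then show ?thesis by (simp add: abs_mult mult_ac)
  qed
  have b2: "\<bar>Q (Suc n) (C p) * \<phi>t p\<bar> \<le> (Bh * 2 + Ba) * \<bar>\<phi>t p\<bar>" for n p
    unfolding abs_mult by (intro mult_right_mono Q_bound C_range) auto
  define E where "E n p = v p * softplus (Suc n) \<xi> (C p) * \<phi>x p + Q (Suc n) (C p) * \<phi>t p" for n p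
  define L where "L p = v p * min (C p) \<xi> * \<phi>x p + (A (min (C p) \<xi>) + h (C p) * min (C p) \<xi>) * \<phi>t p" for p
  have E_nonneg: "0 \<le> integral\<^sup>L lborel (E n)" for n
  proof -
    have "integrable lborel (\<lambda>p. v p * softplus (Suc n) \<xi> (C p) * \<phi>x p)"
      by (rule Bochner_Integration.integrable_bound[OF w1]) (use b1 in \<open>auto intro!: AE_I2\<close>)
    moreover have "integrable lborel (\<lambda>p. Q (Suc n) (C p) * \<phi>t p)"
      by (rule Bochner_Integration.integrable_bound[OF w2])
        (use b2 Bh Ba in \<open>auto intro!: AE_I2 simp: abs_mult\<close>)
    ultimately have "integral\<^sup>L lborel (E n) = (\<integral>p. v p * softplus (Suc n) \<xi> (C p) * \<phi>x p \<partial>lborel) +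
        (\<integral>p. Q (Suc n) (C p) * \<phi>t p \<partial>lborel)"
      unfolding E_def by (rule Bochner_Integration.integral_add)
    also have "0 \<le> \<dots>"
      using softplus_entropy[of "Suc n" \<xi> \<phi>] \<xi> \<phi> unfolding Q_def \<phi>x_def \<phi>t_def by simp
    finally show ?thesis .
  qed
  have "(\<lambda>n. integral\<^sup>L lborel (E n)) \<longlonglongrightarrow> integral\<^sup>L lborel (\<lambda>p. - L p)"
  proof (rule integral_dominated_convergence[OF _ _ w])
    show "(\<lambda>p. - L p) \<in> borel_measurable lborel" "E n \<in> borel_measurable lborel" for n
      unfolding L_def E_def by measurable
    show "AE p in lborel. (\<lambda>n. E n p) \<longlonglongrightarrow> - L p"
    proof (rule AE_I2)
      fix p
      have s: "C p \<in> {0..1}" by (rule C_range)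
      have "(\<lambda>n. E n p) \<longlonglongrightarrow> v p * - min (C p) \<xi> * \<phi>x p +
          (h (C p) * - min (C p) \<xi> + - A (min (C p) \<xi>)) * \<phi>t p"
        unfolding E_def Q_def A_def using \<xi>
        by (intro tendsto_intros softplus_tendsto integral_fermi_tendsto a_cont s) auto
      also have "v p * - min (C p) \<xi> * \<phi>x p +
          (h (C p) * - min (C p) \<xi> + - A (min (C p) \<xi>)) * \<phi>t p = - L p"
        unfolding L_def by (simp add: algebra_simps)
      finally show "(\<lambda>n. E n p) \<longlonglongrightarrow> - L p" .
    qed
    show "AE p in lborel. norm (E n p) \<le> w p" for n
    proof (rule AE_I2)
      fix p show "norm (E n p) \<le> w p"
        using b1[of p n] b2[of n p] unfolding E_def w_def real_norm_def by linarith
    qed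
  qed
  from LIMSEQ_le_const[OF this, of 0] E_nonneg have "0 \<le> integral\<^sup>L lborel (\<lambda>p. - L p)" by auto
  then have "integral\<^sup>L lborel L \<le> 0" by simp
  then show ?thesis unfolding L_def \<phi>x_def \<phi>t_def by simp
qed

text \<open>With \<open>trunc = min C \<xi>\<close>, the functional \<open>defect\<close> is the distribution \<open>\<partial>\<^sub>x flux_x + \<partial>\<^sub>t flux_t\<close>, where the fluxes
  are the integrals over \<open>{0..\<xi>}\<close> of the densities in the kinetic equation. The clamping has no effect
  on \<open>Omega_kin\<close>, but makes the densities bounded everywhere.\<close>

definition trunc :: "real \<times> real \<times> real \<Rightarrow> real" where
  "trunc q = clamp01 (min (C (fst q, fst (snd q))) (snd (snd q)))"

definition flux_x :: "real \<times> real \<times> real \<Rightarrow> real" where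
  "flux_x q = v (fst q, fst (snd q)) * trunc q"

definition flux_t :: "real \<times> real \<times> real \<Rightarrow> real" where
  "flux_t q = A (trunc q) + h (C (fst q, fst (snd q))) * trunc q"

definition defect :: "(real \<times> real \<times> real \<Rightarrow> real) \<Rightarrow> real" where
  "defect \<phi> = - (\<integral>q. flux_x q * frechet_derivative \<phi> (at q) (0, 1, 0) +
      flux_t q * frechet_derivative \<phi> (at q) (1, 0, 0) \<partial>lborel)"

text \<open>\<open>v\<close> is bounded only locally on \<open>Omega\<close>; the relevant compact
  set is the projection of \<open>supp \<phi>\<close>, and the almost sure bound lifts to the
  cylinder over it.\<close>

lemma integrable_v_mult:
  assumes k: "k \<in> borel_measurable borel" "\<And>q. \<bar>k q\<bar> \<le> 1"
    and \<phi>: "\<phi> \<in> test_functions Omega_kin"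
  shows "integrable lborel (\<lambda>q. v (fst q, fst (snd q)) * k q * \<phi> q)"
proof -
  let ?K = "(\<lambda>q. (fst q, fst (snd q))) ` supp \<phi>"
  have "compact ?K" "?K \<subseteq> Omega"
    using \<phi> by (auto simp: test_functions_iff Omega_kin_def Omega_def
        intro!: compact_continuous_image continuous_intros)
  then obtain B where "AE p in lborel. p \<in> ?K \<longrightarrow> \<bar>v p\<bar> \<le> B" using v_bounded by blast
  then have B: "AE q in (lborel :: (real \<times> real \<times> real) measure). (fst q, fst (snd q)) \<in> ?K \<longrightarrow> \<bar>v (fst q, fst (snd q))\<bar> \<le> B"
    using AE_assoc3[of "\<lambda>p. p \<in> ?K \<longrightarrow> \<bar>v p\<bar> \<le> B"] by simp
  show ?thesis
  proof (rule integrable_mult_test_function[OF _ \<phi>])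
    show "(\<lambda>q. v (fst q, fst (snd q)) * k q) \<in> borel_measurable borel"
      by (intro borel_measurable_times k base_measurable v_borel)
    show "AE q in lborel. q \<in> supp \<phi> \<longrightarrow> \<bar>v (fst q, fst (snd q)) * k q\<bar> \<le> B"
      using B
    proof eventually_elim
      case (elim q)
      show ?case
      proof
        assume "q \<in> supp \<phi>"
        then have "\<bar>v (fst q, fst (snd q))\<bar> \<le> B" using elim by blast
        then show "\<bar>v (fst q, fst (snd q)) * k q\<bar> \<le> B"
          using mult_mono[OF _ k(2)[of q], of "\<bar>v (fst q, fst (snd q))\<bar>" B] by (simp add: abs_mult)
      qed
    qed
  qed
qed

lemma trunc_range: "trunc q \<in> {0..1}"
  by (simp add: trunc_def clamp01_bounds)

lemma trunc_measurable: "trunc \<in> borel_measurable borel"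
proof -
  have "(\<lambda>q :: real \<times> real \<times> real. snd (snd q)) \<in> borel_measurable borel"
    by (intro borel_measurable_continuous_onI continuous_intros)
  from borel_measurable_min[OF this base_measurable[OF C_borel]] show ?thesis
    unfolding trunc_def by (rule borel_compose01[OF continuous_on_id])
qed

lemma integrable_flux_x:
  assumes "\<phi> \<in> test_functions Omega_kin"
  shows "integrable lborel (\<lambda>q. flux_x q * \<phi> q)"
proof -
  have "\<bar>trunc q\<bar> \<le> 1" for q using trunc_range[of q] by simp
  from integrable_v_mult[OF trunc_measurable this assms] show ?thesis unfolding flux_x_def .
qed

lemma integrable_flux_t:
  assumes "\<phi> \<in> test_functions Omega_kin"
  shows "integrable lborel (\<lambda>q. flux_t q * \<phi> q)"
proof -
  have "integrable lborel (\<lambda>q. (A (trunc q) * 1) * \<phi> q)"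
    by (rule integrable_bounded_mult[where g = "\<lambda>_. 1" and k = "\<lambda>_. 0",
          OF A_cont _ trunc_measurable trunc_range _ _ assms]) auto
  moreover have "integrable lborel (\<lambda>q. (h (C (fst q, fst (snd q))) * trunc q) * \<phi> q)"
    by (intro integrable_bounded_mult[where f = h and r = "\<lambda>q. C (fst q, fst (snd q))"
          and g = "\<lambda>s. s" and U = Omega_kin] C_range h_cont base_measurable C_borel
        trunc_measurable trunc_range assms continuous_intros)
  ultimately show ?thesis
    using Bochner_Integration.integrable_add by (fastforce simp: flux_t_def distrib_right)
qed

lemma integrable_defect:
  assumes "\<phi> \<in> test_functions Omega_kin"
  shows "integrable lborel (\<lambda>q. flux_x q * frechet_derivative \<phi> (at q) (0, 1, 0) +
      flux_t q * frechet_derivative \<phi> (at q) (1, 0, 0))"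
  using test_functions_frechet_derivative[OF assms kin_basis(1)]
    test_functions_frechet_derivative[OF assms kin_basis(2)]
  by (intro Bochner_Integration.integrable_add integrable_flux_x integrable_flux_t)

text \<open>Fubini with \<xi> as the outer variable: for \<xi> in (0,1) the slice integral is
  nonpositive by \<open>limit_entropy\<close>, and for other \<xi> the slice misses the
  support.\<close>

lemma defect_nonneg:
  assumes \<phi>: "\<phi> \<in> test_functions Omega_kin" and pos: "\<And>q. 0 \<le> \<phi> q"
  shows "0 \<le> defect \<phi>"
proof -
  have "(\<integral>p. flux_x (fst p, snd p, \<xi>) * frechet_derivative \<phi> (at (fst p, snd p, \<xi>)) (0, 1, 0) +
      flux_t (fst p, snd p, \<xi>) * frechet_derivative \<phi> (at (fst p, snd p, \<xi>)) (1, 0, 0) \<partial>lborel) \<le> 0"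
    for \<xi>
  proof (cases "\<xi> \<in> {0<..<1}")
    case True
    have tr: "trunc (fst p, snd p, \<xi>) = min (C p) \<xi>" for p
      using C_range[of p] True unfolding trunc_def by (auto intro: clamp01_id)
    from limit_entropy[OF True test_functions_slice[OF \<phi>, of \<xi>]] pos
    show ?thesis by (simp add: frechet_derivative_slice[OF \<phi>] flux_x_def flux_t_def tr)
  next
    case False
    then have "(fst p, snd p, \<xi>) \<notin> supp \<phi>" for p
      using \<phi> by (auto simp: test_functions_iff Omega_kin_def)
    then show ?thesis by (simp add: frechet_derivative_not_in_supp)
  qed
  then have "0 \<le> (\<integral>\<xi>. - (\<integral>p. flux_x (fst p, snd p, \<xi>) * frechet_derivative \<phi> (at (fst p, snd p, \<xi>)) (0, 1, 0) +
      flux_t (fst p, snd p, \<xi>) * frechet_derivative \<phi> (at (fst p, snd p, \<xi>)) (1, 0, 0) \<partial>lborel) \<partial>lborel)"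
    by (intro Bochner_Integration.integral_nonneg) simp
  then show ?thesis
    unfolding defect_def integral_assoc3_snd[OF integrable_defect[OF \<phi>]] by simp
qed

text \<open>From here on \<open>riesz_measure\<close> denotes the measure representing
  \<open>defect\<close>, that is, the kinetic measure.\<close>

sublocale positive_distribution Omega_kin defect
proof
  show "open Omega_kin" by (rule open_Omega_kin)
  show "defect (\<lambda>p. f p + g p) = defect f + defect g"
    if f: "f \<in> test_functions Omega_kin" and g: "g \<in> test_functions Omega_kin" for f g
  proof -
    have "frechet_derivative (\<lambda>p. f p + g p) (at q) =
        (\<lambda>d. frechet_derivative f (at q) d + frechet_derivative g (at q) d)" for q
      by (intro frechet_derivative_eqI has_derivative_add test_functions_has_derivative[OF f]
          test_functions_has_derivative[OF g])
    then have "defect (\<lambda>p. f p + g p) = - (\<integral>q. (flux_x q * frechet_derivative f (at q) (0, 1, 0) +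
        flux_t q * frechet_derivative f (at q) (1, 0, 0)) + (flux_x q * frechet_derivative g (at q) (0, 1, 0) +
        flux_t q * frechet_derivative g (at q) (1, 0, 0)) \<partial>lborel)"
      by (simp add: defect_def algebra_simps)
    then show ?thesis
      using integrable_defect[OF f] integrable_defect[OF g] by (simp add: defect_def)
  qed
  show "defect (\<lambda>p. r * f p) = r * defect f" if f: "f \<in> test_functions Omega_kin" for f r
  proof -
    have "frechet_derivative (\<lambda>p. r * f p) (at q) = (\<lambda>d. r * frechet_derivative f (at q) d)" for q
      by (intro frechet_derivative_eqI has_derivative_mult_right test_functions_has_derivative[OF f])
    then have "defect (\<lambda>p. r * f p) = - (\<integral>q. r * (flux_x q * frechet_derivative f (at q) (0, 1, 0) +
        flux_t q * frechet_derivative f (at q) (1, 0, 0)) \<partial>lborel)"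
      by (simp add: defect_def algebra_simps)
    then show ?thesis by (simp add: defect_def)
  qed
qed (rule defect_nonneg)

text \<open>Now Fubini has \<xi> as the inner variable. After exchanging mixed derivatives,
  integration by parts at fixed (t,x) turns truncated primitives into densities with
  \<open>chi\<close>; its minus sign cancels the one in \<open>defect\<close>.\<close>

lemma defect_xi_derivative:
  assumes \<phi>: "\<phi> \<in> test_functions Omega_kin"
  defines "\<phi>x \<equiv> \<lambda>q. frechet_derivative \<phi> (at q) (0, 1, 0)"
    and "\<phi>t \<equiv> \<lambda>q. frechet_derivative \<phi> (at q) (1, 0, 0)"
  shows "defect (\<lambda>q. frechet_derivative \<phi> (at q) (0, 0, 1)) =
    (\<integral>q. v (fst q, fst (snd q)) * chi (C (fst q, fst (snd q))) (snd (snd q)) * \<phi>x q \<partial>lborel) +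
    (\<integral>q. a (clamp01 (snd (snd q))) * chi (C (fst q, fst (snd q))) (snd (snd q)) * \<phi>t q \<partial>lborel) +
    (\<integral>q. h (C (fst q, fst (snd q))) * chi (C (fst q, fst (snd q))) (snd (snd q)) * \<phi>t q \<partial>lborel)"
    (is "_ = (\<integral>q. ?X q \<partial>lborel) + (\<integral>q. ?Y q \<partial>lborel) + (\<integral>q. ?Z q \<partial>lborel)")
proof -
  define \<phi>xz where "\<phi>xz q = frechet_derivative \<phi>x (at q) (0, 0, 1)" for q
  define \<phi>tz where "\<phi>tz q = frechet_derivative \<phi>t (at q) (0, 0, 1)" for q
  let ?\<phi>z = "\<lambda>q. frechet_derivative \<phi> (at q) (0, 0, 1)"
  have \<phi>z: "?\<phi>z \<in> test_functions Omega_kin"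
    by (rule test_functions_frechet_derivative[OF \<phi> kin_basis(3)])
  have \<phi>x: "\<phi>x \<in> test_functions Omega_kin" and \<phi>t: "\<phi>t \<in> test_functions Omega_kin"
    unfolding \<phi>x_def \<phi>t_def by (intro test_functions_frechet_derivative \<phi> kin_basis)+
  have \<phi>xz: "\<phi>xz \<in> test_functions Omega_kin" and \<phi>tz: "\<phi>tz \<in> test_functions Omega_kin"
    unfolding \<phi>xz_def \<phi>tz_def by (intro test_functions_frechet_derivative \<phi>x \<phi>t kin_basis)+
  have swap: "frechet_derivative ?\<phi>z (at q) (0, 1, 0) = \<phi>xz q"
      "frechet_derivative ?\<phi>z (at q) (1, 0, 0) = \<phi>tz q" for q
    unfolding \<phi>xz_def \<phi>tz_def \<phi>x_def \<phi>t_def by (intro frechet_derivative_swap[OF \<phi>] kin_basis)+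
  have chi_meas: "(\<lambda>q. chi (C (fst q, fst (snd q))) (snd (snd q))) \<in> borel_measurable borel"
  proof -
    have [measurable]: "(\<lambda>q :: real \<times> real \<times> real. snd (snd q)) \<in> borel_measurable borel"
      by (intro borel_measurable_continuous_onI continuous_intros)
    note [measurable] = base_measurable[OF C_borel]
    show ?thesis unfolding chi_def by measurable
  qed
  have chi_range: "chi s \<xi> \<in> {0..1}" for s \<xi> by (simp add: chi_def)
  have iX: "integrable lborel ?X"
    by (rule integrable_v_mult[OF chi_meas _ \<phi>x]) (simp add: chi_def)
  have "(\<lambda>q :: real \<times> real \<times> real. clamp01 (snd (snd q))) \<in> borel_measurable borel"
    by (intro borel_compose01[where f = "\<lambda>s. s"] borel_measurable_continuous_onI continuous_intros)
  then have iY: "integrable lborel ?Y"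
    by (intro integrable_bounded_mult[where f = a and r = "\<lambda>q. clamp01 (snd (snd q))" and g = "\<lambda>s. s"
        and U = Omega_kin] a_cont chi_meas chi_range \<phi>t continuous_intros)
      (auto simp: clamp01_bounds)
  have iZ: "integrable lborel ?Z"
    by (intro integrable_bounded_mult[where f = h and r = "\<lambda>q. C (fst q, fst (snd q))"
          and g = "\<lambda>s. s" and U = Omega_kin] h_cont chi_meas chi_range \<phi>t continuous_intros
        base_measurable C_borel C_range)
  have iXYZ: "integrable lborel (\<lambda>q. ?X q + ?Y q + ?Z q)"
    by (intro Bochner_Integration.integrable_add iX iY iZ)
  have iF: "integrable lborel (\<lambda>q. flux_x q * \<phi>xz q + flux_t q * \<phi>tz q)"
    by (intro Bochner_Integration.integrable_add integrable_flux_x integrable_flux_t \<phi>xz \<phi>tz)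
  have inner: "(\<integral>\<xi>. flux_x (fst p, snd p, \<xi>) * \<phi>xz (fst p, snd p, \<xi>) +
        flux_t (fst p, snd p, \<xi>) * \<phi>tz (fst p, snd p, \<xi>) \<partial>lborel) =
      - (\<integral>\<xi>. ?X (fst p, snd p, \<xi>) + ?Y (fst p, snd p, \<xi>) + ?Z (fst p, snd p, \<xi>) \<partial>lborel)" for p
  proof -
    let ?k = "\<lambda>\<xi>. clamp01 (min (C p) \<xi>)"
    have dx: "((\<lambda>\<xi>. \<phi>x (fst p, snd p, \<xi>)) has_real_derivative \<phi>xz (fst p, snd p, \<xi>)) (at \<xi>)"
      and dt: "((\<lambda>\<xi>. \<phi>t (fst p, snd p, \<xi>)) has_real_derivative \<phi>tz (fst p, snd p, \<xi>)) (at \<xi>)" for \<xi>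
      unfolding \<phi>xz_def \<phi>tz_def
      by (rule test_functions_kin_line_derivative[OF \<phi>x] test_functions_kin_line_derivative[OF \<phi>t])+
    have cx: "continuous_on UNIV (\<lambda>\<xi>. \<phi>xz (fst p, snd p, \<xi>))"
      and ct: "continuous_on UNIV (\<lambda>\<xi>. \<phi>tz (fst p, snd p, \<xi>))"
      by (rule continuous_on_compose2[OF test_functions_continuous[OF \<phi>xz]]
          continuous_on_compose2[OF test_functions_continuous[OF \<phi>tz]];
          auto intro!: continuous_intros)+
    note z = test_functions_kin_zero
    \<comment> \<open>The constant 1 has the truncation itself as primitive and serves the terms
      with \<open>v\<close> and \<open>h\<close>, whose coefficients are free of \<xi>; the density
      \<open>a\<close> has primitive \<open>A\<close>.\<close>
    note X1 = integrable_truncated_primitive[OF continuous_on_const[of _ 1] C_range[of p] dx cx z[OF \<phi>x] z[OF \<phi>xz]]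
      and X2 = integrable_chi[OF continuous_on_const[of _ 1] C_range[of p] dx cx z[OF \<phi>x] z[OF \<phi>xz]]
      and X3 = lborel_integral_by_parts[OF continuous_on_const[of _ 1] C_range[of p] dx cx z[OF \<phi>x] z[OF \<phi>xz]]
      and Y1 = integrable_truncated_primitive[OF a_cont C_range[of p] dt ct z[OF \<phi>t] z[OF \<phi>tz]]
      and Y2 = integrable_chi[OF a_cont C_range[of p] dt ct z[OF \<phi>t] z[OF \<phi>tz]]
      and Y3 = lborel_integral_by_parts[OF a_cont C_range[of p] dt ct z[OF \<phi>t] z[OF \<phi>tz]]
      and Z1 = integrable_truncated_primitive[OF continuous_on_const[of _ 1] C_range[of p] dt ct z[OF \<phi>t] z[OF \<phi>tz]]
      and Z2 = integrable_chi[OF continuous_on_const[of _ 1] C_range[of p] dt ct z[OF \<phi>t] z[OF \<phi>tz]]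
      and Z3 = lborel_integral_by_parts[OF continuous_on_const[of _ 1] C_range[of p] dt ct z[OF \<phi>t] z[OF \<phi>tz]]
    have one: "integral {0..?k \<xi>} (\<lambda>_. 1) = ?k \<xi>" for \<xi>
      using clamp01_bounds by simp
    have "(\<integral>\<xi>. flux_x (fst p, snd p, \<xi>) * \<phi>xz (fst p, snd p, \<xi>) +
        flux_t (fst p, snd p, \<xi>) * \<phi>tz (fst p, snd p, \<xi>) \<partial>lborel) =
      (\<integral>\<xi>. v p * (?k \<xi> * \<phi>xz (fst p, snd p, \<xi>)) + (A (?k \<xi>) * \<phi>tz (fst p, snd p, \<xi>) +
        h (C p) * (?k \<xi> * \<phi>tz (fst p, snd p, \<xi>))) \<partial>lborel)"
      by (simp add: flux_x_def flux_t_def trunc_def algebra_simps)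
    also have "\<dots> = v p * (\<integral>\<xi>. ?k \<xi> * \<phi>xz (fst p, snd p, \<xi>) \<partial>lborel) +
        ((\<integral>\<xi>. A (?k \<xi>) * \<phi>tz (fst p, snd p, \<xi>) \<partial>lborel) +
        h (C p) * (\<integral>\<xi>. ?k \<xi> * \<phi>tz (fst p, snd p, \<xi>) \<partial>lborel))"
      using X1 Y1 Z1 unfolding one A_def
      by (simp add: Bochner_Integration.integral_add)
    also have "\<dots> = - (v p * (\<integral>\<xi>. chi (C p) \<xi> * \<phi>x (fst p, snd p, \<xi>) \<partial>lborel) +
        ((\<integral>\<xi>. a (clamp01 \<xi>) * chi (C p) \<xi> * \<phi>t (fst p, snd p, \<xi>) \<partial>lborel) +
        h (C p) * (\<integral>\<xi>. chi (C p) \<xi> * \<phi>t (fst p, snd p, \<xi>) \<partial>lborel)))"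
      using X3 Y3 Z3 unfolding one A_def by simp
    also have "v p * (\<integral>\<xi>. chi (C p) \<xi> * \<phi>x (fst p, snd p, \<xi>) \<partial>lborel) +
        ((\<integral>\<xi>. a (clamp01 \<xi>) * chi (C p) \<xi> * \<phi>t (fst p, snd p, \<xi>) \<partial>lborel) +
        h (C p) * (\<integral>\<xi>. chi (C p) \<xi> * \<phi>t (fst p, snd p, \<xi>) \<partial>lborel)) =
      (\<integral>\<xi>. v p * (chi (C p) \<xi> * \<phi>x (fst p, snd p, \<xi>)) +
        (a (clamp01 \<xi>) * chi (C p) \<xi> * \<phi>t (fst p, snd p, \<xi>) +
        h (C p) * (chi (C p) \<xi> * \<phi>t (fst p, snd p, \<xi>))) \<partial>lborel)"
      using X2 Y2 Z2 by (simp add: Bochner_Integration.integral_add)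
    also have "\<dots> = (\<integral>\<xi>. ?X (fst p, snd p, \<xi>) + ?Y (fst p, snd p, \<xi>) + ?Z (fst p, snd p, \<xi>) \<partial>lborel)"
      by (simp add: algebra_simps)
    finally show ?thesis .
  qed
  have "defect ?\<phi>z = - (\<integral>q. flux_x q * \<phi>xz q + flux_t q * \<phi>tz q \<partial>lborel)"
    unfolding defect_def swap ..
  also have "\<dots> = (\<integral>q. ?X q + ?Y q + ?Z q \<partial>lborel)"
    unfolding integral_assoc3_fst[OF iF] integral_assoc3_fst[OF iXYZ] inner by simp
  also have "\<dots> = (\<integral>q. ?X q \<partial>lborel) + (\<integral>q. ?Y q \<partial>lborel) + (\<integral>q. ?Z q \<partial>lborel)"
    using iX iY iZ by simp
  finally show ?thesis .
qed

end

section \<open>The kinetic formulation\<close>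

lemma isotherms_derivatives:
  assumes iso: "isotherms q1 q2" and c: "c \<in> {0..1}"
  shows "(q1 has_real_derivative D01 q1 c) (at c within {0..1})"
    and "(iso_h q1 q2 has_real_derivative D01 (iso_h q1 q2) c) (at c within {0..1})"
    and "D01 (iso_h q1 q2) c = D01 q1 c + D01 q2 c"
proof -
  show q1: "(q1 has_real_derivative D01 q1 c) (at c within {0..1})"
    using iso c by (intro D01_works) (auto simp: isotherms_def C1_on01_def)
  have "(q2 has_real_derivative D01 q2 c) (at c within {0..1})"
    using iso c by (intro D01_works) (auto simp: isotherms_def C1_on01_def)
  from DERIV_add[OF q1 this]
  have h: "(iso_h q1 q2 has_real_derivative D01 q1 c + D01 q2 c) (at c within {0..1})"
    unfolding iso_h_def .
  then show "D01 (iso_h q1 q2) c = D01 q1 c + D01 q2 c" by (rule D01_eqI[OF _ c])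
  with h show "(iso_h q1 q2 has_real_derivative D01 (iso_h q1 q2) c) (at c within {0..1})" by simp
qed

lemma iso_a_eq:
  assumes "isotherms q1 q2" "c \<in> {0..1}"
  shows "iso_a q1 q2 c = 1 + D01 (iso_f q1 q2) c"
proof -
  note d = isotherms_derivatives[OF assms]
  have "(iso_f q1 q2 has_real_derivative
      D01 q1 c - (1 * iso_h q1 q2 c + D01 (iso_h q1 q2) c * c)) (at c within {0..1})"
    unfolding iso_f_def by (rule DERIV_diff[OF d(1) DERIV_mult[OF DERIV_ident d(2)]])
  from D01_eqI[OF this assms(2)] show ?thesis
    by (simp add: iso_a_def iso_H_def algebra_simps)
qed

lemma isotherms_continuous:
  assumes "isotherms q1 q2"
  shows "continuous_on {0..1} (iso_h q1 q2)" and "continuous_on {0..1} (iso_a q1 q2)"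
proof -
  show h: "continuous_on {0..1} (iso_h q1 q2)"
    by (rule DERIV_continuous_on[OF isotherms_derivatives(2)[OF assms]])
  \<comment> \<open>Continuity is assumed for the derivatives of \<open>q1\<close> and
    \<open>q2\<close>, so \<open>D01\<close> of \<open>iso_h\<close> is first split into these
    two.\<close>
  have "continuous_on {0..1} (\<lambda>c. 1 + D01 q1 c - c * (D01 q1 c + D01 q2 c) - iso_h q1 q2 c)"
    using assms h by (intro continuous_intros) (auto simp: isotherms_def C1_on01_def)
  then show "continuous_on {0..1} (iso_a q1 q2)"
    by (rule continuous_on_eq) (simp add: iso_a_def iso_H_def isotherms_derivatives(3)[OF assms])
qed

text \<open>The entropy flux is \<open>Q = h \<psi> + \<integral> a \<psi>'\<close>: indeed \<open>Q' = h' \<psi> + (h + a) \<psi>'\<close> and \<open>H = h + a\<close>.\<close>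

lemma softplus_entropy_flux:
  assumes iso: "isotherms q1 q2" and n: "0 < n" and s: "s \<in> {0..1}"
  shows "((\<lambda>s. iso_h q1 q2 s * softplus n \<xi> s + integral {0..s} (\<lambda>r. iso_a q1 q2 r * - fermi n \<xi> r))
    has_real_derivative D01 (iso_h q1 q2) s * softplus n \<xi> s + iso_H q1 q2 s * D01 (softplus n \<xi>) s)
    (at s within {0..1})"
proof -
  have "continuous_on {0..1} (\<lambda>r. iso_a q1 q2 r * - fermi n \<xi> r)"
    by (intro continuous_intros isotherms_continuous[OF iso] DERIV_continuous_on[OF fermi_has_derivative])
  from DERIV_add[OF DERIV_mult[OF isotherms_derivatives(2)[OF iso s] softplus_has_derivative[OF n]]
      integral_has_real_derivative[OF this s]]
  show ?thesis
    by (rule DERIV_cong) (simp add: D01_softplus[OF n s] iso_a_def algebra_simps)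
qed

theorem theorem4p1:
  fixes q1 q2 :: "real \<Rightarrow> real"
    and u c :: "real \<times> real \<Rightarrow> real"
  assumes "isotherms q1 q2"
    and "weak_entropy_solution q1 q2 u c"
  shows "(\<exists>m :: (real \<times> real \<times> real) measure.
            radon_measure_on Omega_kin m \<and> kinetic_equation q1 q2 u c m) \<and>
         (\<forall>\<xi>\<in>{0..1}. iso_a q1 q2 \<xi> = 1 + D01 (iso_f q1 q2) \<xi>)"
proof (intro conjI ballI iso_a_eq[OF assms(1)])
  note iso = assms(1)
  let ?h = "iso_h q1 q2" and ?a = "iso_a q1 q2"
  have c_meas: "c \<in> borel_measurable (lebesgue_on Omega)"
    and c_range: "AE p in lebesgue_on Omega. c p \<in> {0..1}"
    and u_loc: "Linf_loc Omega u"
    and entropy: "entropy_condition q1 q2 u c"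
    using assms(2) by (auto simp: weak_entropy_solution_def)
  have OL: "Omega \<in> sets lebesgue" using open_Omega by auto
  obtain v where v: "v \<in> borel_measurable borel" "AE p in lborel. p \<in> Omega \<longrightarrow> u p = v p"
    using borel_representative[OF _ open_Omega] u_loc unfolding Linf_loc_def by metis
  obtain C0 where C0: "C0 \<in> borel_measurable borel" "AE p in lborel. p \<in> Omega \<longrightarrow> c p = C0 p"
    using borel_representative[OF c_meas open_Omega] by metis
  \<comment> \<open>Within \<open>Omega\<close> the clamping changes \<open>C0\<close> only on a
    null set, but it makes the range condition hold at every point.\<close>
  define C where "C p = clamp01 (C0 p)" for p
  have C_borel: "C \<in> borel_measurable borel"
    using C0(1) unfolding C_def clamp01_def by measurable
  have C_range: "C p \<in> {0..1}" for p by (simp add: C_def clamp01_bounds)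
  have cC: "AE p in lborel. p \<in> Omega \<longrightarrow> c p = C p"
    using C0(2) c_range[unfolded AE_lebesgue_on_iff[OF OL]]
    by eventually_elim (auto simp: C_def clamp01_id)
  have v_bounded: "\<exists>B. AE p in lborel. p \<in> K \<longrightarrow> \<bar>v p\<bar> \<le> B" if K: "compact K" "K \<subseteq> Omega" for K
  proof -
    obtain B where "AE p in lebesgue_on K. \<bar>u p\<bar> \<le> B"
      using u_loc K unfolding Linf_loc_def by blast
    moreover have "K \<in> sets lebesgue" using K(1) by (simp add: borel_compact)
    ultimately have "AE p in lborel. p \<in> K \<longrightarrow> \<bar>u p\<bar> \<le> B" by (simp add: AE_lebesgue_on_iff)
    with v(2) have "AE p in lborel. p \<in> K \<longrightarrow> \<bar>v p\<bar> \<le> B"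
      by eventually_elim (use K(2) in auto)
    then show ?thesis by blast
  qed
  have compose_C: "(\<lambda>p. f (C p)) \<in> borel_measurable borel" if "continuous_on {0..1} f"
    for f :: "real \<Rightarrow> real"
    using borel_compose01[OF that C_borel] by (simp only: clamp01_id[OF C_range])
  interpret kinetic_setting ?h ?a v C
  proof
    fix n :: nat and \<xi> :: real and \<phi> :: "real \<times> real \<Rightarrow> real"
    assume n: "0 < n" and \<phi>: "\<phi> \<in> test_functions Omega" "\<And>p. 0 \<le> \<phi> p"
    define Q where "Q s = ?h s * softplus n \<xi> s + integral {0..s} (\<lambda>r. ?a r * - fermi n \<xi> r)" for s
    have Q: "(Q has_real_derivative D01 ?h s * softplus n \<xi> s + iso_H q1 q2 s * D01 (softplus n \<xi>) s)
        (at s within {0..1})" if "s \<in> {0..1}" for s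
      unfolding Q_def by (rule softplus_entropy_flux[OF iso n that])
    \<comment> \<open>The only use of the entropy condition: the softplus function as \<psi>, with
      the flux that vanishes up to the term with \<open>h\<close> at 0.\<close>
    have "balance (\<lambda>p. u p * softplus n \<xi> (c p)) (\<lambda>p. Q (c p)) \<phi> \<le> 0"
      using entropy smooth_on01_softplus[OF n] softplus_convex[OF n] Q \<phi>
      unfolding entropy_condition_def by blast
    moreover have "dist_fun Omega (\<lambda>p. u p * softplus n \<xi> (c p)) (\<lambda>p. frechet_derivative \<phi> (at p) (0, 1)) =
        (\<integral>p. v p * softplus n \<xi> (C p) * frechet_derivative \<phi> (at p) (0, 1) \<partial>lborel)"
    proof (rule dist_fun_borel[OF open_Omega])
      show "(\<lambda>p. v p * softplus n \<xi> (C p)) \<in> borel_measurable borel"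
        by (intro borel_measurable_times v compose_C DERIV_continuous_on[OF softplus_has_derivative[OF n]])
      show "AE p in lborel. p \<in> Omega \<longrightarrow> u p * softplus n \<xi> (c p) = v p * softplus n \<xi> (C p)"
        using v(2) cC by eventually_elim auto
    qed (intro test_functions_frechet_derivative \<phi>; simp add: Basis_prod_def zero_prod_def)
    moreover have "dist_fun Omega (\<lambda>p. Q (c p)) (\<lambda>p. frechet_derivative \<phi> (at p) (1, 0)) =
        (\<integral>p. Q (C p) * frechet_derivative \<phi> (at p) (1, 0) \<partial>lborel)"
    proof (rule dist_fun_borel[OF open_Omega])
      show "(\<lambda>p. Q (C p)) \<in> borel_measurable borel"
        by (intro compose_C DERIV_continuous_on[OF Q])
      show "AE p in lborel. p \<in> Omega \<longrightarrow> Q (c p) = Q (C p)"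
        using cC by eventually_elim auto
    qed (intro test_functions_frechet_derivative \<phi>; simp add: Basis_prod_def zero_prod_def)
    ultimately show "0 \<le> (\<integral>p. v p * softplus n \<xi> (C p) * frechet_derivative \<phi> (at p) (0, 1) \<partial>lborel) +
        (\<integral>p. (?h (C p) * softplus n \<xi> (C p) + integral {0..C p} (\<lambda>r. ?a r * - fermi n \<xi> r)) *
          frechet_derivative \<phi> (at p) (1, 0) \<partial>lborel)"
      by (simp add: balance_def dist_deriv_def Q_def)
  qed (intro isotherms_continuous[OF iso] C_borel C_range v(1) v_bounded; assumption)+
  \<comment> \<open>Both sides carry the minus sign of \<open>dist_deriv\<close>. By the Riesz
    representation the right one is minus \<open>defect\<close> of the \<xi>-derivative, which
    equals minus the three integrals on the left.\<close>
  have "kinetic_equation q1 q2 u c riesz_measure"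
    unfolding kinetic_equation_def
  proof
    fix \<phi> :: "real \<times> real \<times> real \<Rightarrow> real"
    assume \<phi>: "\<phi> \<in> test_functions Omega_kin"
    let ?b = "\<lambda>q :: real \<times> real \<times> real. (fst q, fst (snd q))" and ?\<xi> = "\<lambda>q :: real \<times> real \<times> real. snd (snd q)"
    have b_Omega: "?b q \<in> Omega" and \<xi>_range: "?\<xi> q \<in> {0..1}" if "q \<in> Omega_kin" for q
      using that by (auto simp: Omega_kin_def Omega_def)
    have uv: "AE q in lborel. q \<in> Omega_kin \<longrightarrow> u (?b q) = v (?b q)"
      using AE_assoc3[OF v(2)] by eventually_elim (use b_Omega in auto)
    have cC3: "AE q in lborel. q \<in> Omega_kin \<longrightarrow> c (?b q) = C (?b q)"
      using AE_assoc3[OF cC] by eventually_elim (use b_Omega in auto)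
    have \<xi>_borel: "?\<xi> \<in> borel_measurable borel"
      by (intro borel_measurable_continuous_onI continuous_intros)
    have chi_borel: "(\<lambda>q. chi (C (?b q)) (?\<xi> q)) \<in> borel_measurable borel"
    proof -
      note [measurable] = base_measurable[OF C_borel] \<xi>_borel
      show ?thesis unfolding chi_def by measurable
    qed
    note D = test_functions_frechet_derivative[OF \<phi>]
    have X: "dist_fun Omega_kin (\<lambda>(t, x, \<xi>). u (t, x) * chi (c (t, x)) \<xi>)
          (\<lambda>q. frechet_derivative \<phi> (at q) (0, 1, 0)) =
        (\<integral>q. v (?b q) * chi (C (?b q)) (?\<xi> q) * frechet_derivative \<phi> (at q) (0, 1, 0) \<partial>lborel)"
    proof (rule dist_fun_borel[OF open_Omega_kin D[OF kin_basis(2)]])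
      show "(\<lambda>q. v (?b q) * chi (C (?b q)) (?\<xi> q)) \<in> borel_measurable borel"
        by (intro borel_measurable_times base_measurable v chi_borel)
      show "AE q in lborel. q \<in> Omega_kin \<longrightarrow>
          (case q of (t, x, \<xi>) \<Rightarrow> u (t, x) * chi (c (t, x)) \<xi>) = v (?b q) * chi (C (?b q)) (?\<xi> q)"
        using uv cC3 by eventually_elim (auto simp: case_prod_beta)
    qed
    have Y: "dist_fun Omega_kin (\<lambda>(t, x, \<xi>). ?a \<xi> * chi (c (t, x)) \<xi>)
          (\<lambda>q. frechet_derivative \<phi> (at q) (1, 0, 0)) =
        (\<integral>q. ?a (clamp01 (?\<xi> q)) * chi (C (?b q)) (?\<xi> q) * frechet_derivative \<phi> (at q) (1, 0, 0) \<partial>lborel)"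
    proof (rule dist_fun_borel[OF open_Omega_kin D[OF kin_basis(1)]])
      show "(\<lambda>q. ?a (clamp01 (?\<xi> q)) * chi (C (?b q)) (?\<xi> q)) \<in> borel_measurable borel"
        by (intro borel_measurable_times chi_borel borel_compose01[OF a_cont \<xi>_borel])
      show "AE q in lborel. q \<in> Omega_kin \<longrightarrow>
          (case q of (t, x, \<xi>) \<Rightarrow> ?a \<xi> * chi (c (t, x)) \<xi>) = ?a (clamp01 (?\<xi> q)) * chi (C (?b q)) (?\<xi> q)"
        using cC3 by eventually_elim (auto simp: case_prod_beta clamp01_id[OF \<xi>_range])
    qed
    have Z: "dist_fun Omega_kin (\<lambda>(t, x, \<xi>). ?h (c (t, x)) * chi (c (t, x)) \<xi>)
          (\<lambda>q. frechet_derivative \<phi> (at q) (1, 0, 0)) =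
        (\<integral>q. ?h (C (?b q)) * chi (C (?b q)) (?\<xi> q) * frechet_derivative \<phi> (at q) (1, 0, 0) \<partial>lborel)"
    proof (rule dist_fun_borel[OF open_Omega_kin D[OF kin_basis(1)]])
      show "(\<lambda>q. ?h (C (?b q)) * chi (C (?b q)) (?\<xi> q)) \<in> borel_measurable borel"
        by (intro borel_measurable_times chi_borel base_measurable[OF compose_C[OF h_cont]])
      show "AE q in lborel. q \<in> Omega_kin \<longrightarrow>
          (case q of (t, x, \<xi>) \<Rightarrow> ?h (c (t, x)) * chi (c (t, x)) \<xi>) = ?h (C (?b q)) * chi (C (?b q)) (?\<xi> q)"
        using cC3 by eventually_elim (auto simp: case_prod_beta)
    qed
    show "dist_deriv (0, 1, 0) (dist_fun Omega_kin (\<lambda>(t, x, \<xi>). u (t, x) * chi (c (t, x)) \<xi>)) \<phi>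
        + dist_deriv (1, 0, 0) (dist_fun Omega_kin (\<lambda>(t, x, \<xi>). ?a \<xi> * chi (c (t, x)) \<xi>)) \<phi>
        + dist_deriv (1, 0, 0) (dist_fun Omega_kin (\<lambda>(t, x, \<xi>). ?h (c (t, x)) * chi (c (t, x)) \<xi>)) \<phi>
        = dist_deriv (0, 0, 1) (dist_measure riesz_measure) \<phi>"
      unfolding dist_deriv_def dist_measure_def X Y Z
        riesz_representation[OF D[OF kin_basis(3)], symmetric] defect_xi_derivative[OF \<phi>]
      by simp
  qed
  with riesz_measure_radon show "\<exists>m. radon_measure_on Omega_kin m \<and> kinetic_equation q1 q2 u c m"
    by blast
qed

end
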